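(* Let $\Phi: H_n \to H_k$ be a unital quantum channel. Then: (1) $\displaystyle \lim_{N \to \infty} \frac 1 N S_{\min}\left(\Phi^{\otimes N}\right) \geq - \log \gamma (\Phi)$; (2) $C(\Phi) \leq \log k + \log \gamma (\Phi)$.
   Context: $H_n$ is the real vector space of $n\times n$ complex Hermitian matrices with inner product $\langle X,Y\rangle={\rm Tr}(XY)$; $H_{n,0}$ is its subspace of traceless matrices, and $H_{n,+,1}$ the set of density matrices. A quantum channel is a completely positive trace-preserving linear map; $\Phi: H_n\to H_k$ is unital if $\Phi(I_n/n)=I_k/k$. The von Neumann entropy is $S(\sigma)=-{\rm Tr}[\sigma\log\sigma]$ (log in a fixed base, used consistently throughout), and $S_{\min}(\Phi)=\min_{\rho\in H_{n,+,1}} S(\Phi(\rho))$. The Holevo quantity is $\chi(\Phi)=\max\left[S\left(\sum_i p_i\Phi(\rho_i)\right)-\sum_i p_i S(\Phi(\rho_i))\right]$, the maximum over finite ensembles of states $\rho_i$ with probabilities $p_i$, and the classical capacity is $C(\Phi)=\lim_{N\to\infty}\frac1N\chi(\Phi^{\otimes N})$. Fix an orthonormal basis $M_1,\dots,M_{n^2-1}$ of $H_{n,0}$ and define the real symmetric positive semidefinite $(n^2-1)\times(n^2-1)$ matrix $A_\Phi$ by $(A_\Phi)_{i,j}={\rm Tr}[\Phi(M_i)\Phi(M_j)]$; its operator norm (largest eigenvalue) $\|A_\Phi\|_\infty$ does not depend on the choice of basis. Define $\gamma(\Phi)=\frac1k+\left(1-\frac1n\right)\|A_\Phi\|_\infty$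 if $n\geq k\|A_\Phi\|_\infty$, and $\gamma(\Phi)=\|A_\Phi\|_\infty$ if $n<k\|A_\Phi\|_\infty$. *)

theory Defs
  imports Complex_Main "Jordan_Normal_Form.Matrix"
begin

definition mtrace :: "complex mat \<Rightarrow> complex" where
  "mtrace A = (\<Sum>i<dim_row A. A $$ (i,i))"

definition adj :: "complex mat \<Rightarrow> complex mat" where
  "adj A = mat (dim_col A) (dim_row A) (\<lambda>(i,j). cnj (A $$ (j,i)))"

definition hermitian :: "nat \<Rightarrow> complex mat \<Rightarrow> bool" where
  "hermitian n A \<longleftrightarrow> A \<in> carrier_mat n n \<and> adj A = A"

definition psd :: "nat \<Rightarrow> complex mat \<Rightarrow> bool" where
  "psd n A \<longleftrightarrow> hermitian n A \<and>
     (\<forall>v \<in> carrier_vec n. 0 \<le> Re (map_vec cnj v \<bullet> (A *\<^sub>v v)))"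

definition density :: "nat \<Rightarrow> complex mat \<Rightarrow> bool" where
  "density n \<rho> \<longleftrightarrow> psd n \<rho> \<and> mtrace \<rho> = 1"

definition unitary :: "nat \<Rightarrow> complex mat \<Rightarrow> bool" where
  "unitary n U \<longleftrightarrow> U \<in> carrier_mat n n \<and> U * adj U = 1\<^sub>m n"

definition spectral_decomp :: "nat \<Rightarrow> complex mat \<Rightarrow> complex mat \<Rightarrow> (nat \<Rightarrow> real) \<Rightarrow> bool" where
  "spectral_decomp n A U d \<longleftrightarrow>
     unitary n U \<and> A = U * mat_diag n (\<lambda>i. complex_of_real (d i)) * adj U"

text \<open>b is the fixed base of the logarithm; the convention 0 log 0 = 0 holds since 0 * x = 0\<close>
definition vn_entropy :: "real \<Rightarrow> complex mat \<Rightarrow> real" where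
  "vn_entropy b \<sigma> =
     (let n = dim_row \<sigma>; d = (SOME d. \<exists>U. spectral_decomp n \<sigma> U d)
      in - (\<Sum>i<n. d i * log b (d i)))"

definition linear_map_on :: "nat \<Rightarrow> nat \<Rightarrow> (complex mat \<Rightarrow> complex mat) \<Rightarrow> bool" where
  "linear_map_on n k \<Phi> \<longleftrightarrow>
     (\<forall>X \<in> carrier_mat n n. \<Phi> X \<in> carrier_mat k k) \<and>
     (\<forall>X \<in> carrier_mat n n. \<forall>Y \<in> carrier_mat n n. \<Phi> (X + Y) = \<Phi> X + \<Phi> Y) \<and>
     (\<forall>c. \<forall>X \<in> carrier_mat n n. \<Phi> (c \<cdot>\<^sub>m X) = c \<cdot>\<^sub>m \<Phi> X)"

definition munit :: "nat \<Rightarrow> nat \<Rightarrow> nat \<Rightarrow> complex mat" where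
  "munit n i j = mat n n (\<lambda>(r,s). if r = i \<and> s = j then 1 else 0)"

text \<open>Tensor product of linear maps Psi : M_a -> M_a' and Phi : M_n -> M_k,
  i.e. the linear map on M_(a*n) with (Psi (x) Phi)(A (x) B) = Psi(A) (x) Phi(B),
  Kronecker convention (A (x) B)_{(i*n+p),(j*n+q)} = A_ij B_pq.\<close>
definition tensor_map ::
  "(complex mat \<Rightarrow> complex mat) \<Rightarrow> nat \<Rightarrow> nat \<Rightarrow> (complex mat \<Rightarrow> complex mat) \<Rightarrow> nat \<Rightarrow> nat
    \<Rightarrow> complex mat \<Rightarrow> complex mat" where
  "tensor_map \<Psi> a a' \<Phi> n k X =
     mat (a' * k) (a' * k) (\<lambda>(r,s).
       \<Sum>i<a. \<Sum>j<a. \<Sum>p<n. \<Sum>q<n.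
         X $$ (i * n + p, j * n + q) * (\<Psi> (munit a i j) $$ (r div k, s div k))
           * (\<Phi> (munit n p q) $$ (r mod k, s mod k)))"

definition completely_positive :: "nat \<Rightarrow> nat \<Rightarrow> (complex mat \<Rightarrow> complex mat) \<Rightarrow> bool" where
  "completely_positive n k \<Phi> \<longleftrightarrow>
     (\<forall>m X. psd (m * n) X \<longrightarrow> psd (m * k) (tensor_map (\<lambda>Y. Y) m m \<Phi> n k X))"

definition trace_preserving :: "nat \<Rightarrow> (complex mat \<Rightarrow> complex mat) \<Rightarrow> bool" where
  "trace_preserving n \<Phi> \<longleftrightarrow> (\<forall>X \<in> carrier_mat n n. mtrace (\<Phi> X) = mtrace X)"

definition quantum_channel :: "nat \<Rightarrow> nat \<Rightarrow> (complex mat \<Rightarrow> complex mat) \<Rightarrow> bool" where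
  "quantum_channel n k \<Phi> \<longleftrightarrow>
     linear_map_on n k \<Phi> \<and> completely_positive n k \<Phi> \<and> trace_preserving n \<Phi>"

definition unital :: "nat \<Rightarrow> nat \<Rightarrow> (complex mat \<Rightarrow> complex mat) \<Rightarrow> bool" where
  "unital n k \<Phi> \<longleftrightarrow>
     \<Phi> ((1 / of_nat n) \<cdot>\<^sub>m 1\<^sub>m n) = (1 / of_nat k) \<cdot>\<^sub>m 1\<^sub>m k"

fun channel_tpow ::
  "(complex mat \<Rightarrow> complex mat) \<Rightarrow> nat \<Rightarrow> nat \<Rightarrow> nat \<Rightarrow> complex mat \<Rightarrow> complex mat" where
  "channel_tpow \<Phi> n k 0 = (\<lambda>X. X)"
| "channel_tpow \<Phi> n k (Suc N) = tensor_map (channel_tpow \<Phi> n k N) (n ^ N) (k ^ N) \<Phi> n k"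

definition S_min :: "real \<Rightarrow> nat \<Rightarrow> (complex mat \<Rightarrow> complex mat) \<Rightarrow> real" where
  "S_min b n \<Phi> = Inf ((\<lambda>\<rho>. vn_entropy b (\<Phi> \<rho>)) ` {\<rho>. density n \<rho>})"

definition ensemble :: "nat \<Rightarrow> (real \<times> complex mat) list \<Rightarrow> bool" where
  "ensemble n E \<longleftrightarrow> (\<forall>(p,\<rho>) \<in> set E. 0 \<le> p \<and> density n \<rho>) \<and> (\<Sum>(p,\<rho>)\<leftarrow>E. p) = 1"

definition holevo_value ::
  "real \<Rightarrow> nat \<Rightarrow> (complex mat \<Rightarrow> complex mat) \<Rightarrow> (real \<times> complex mat) list \<Rightarrow> real" where
  "holevo_value b k \<Phi> E =
     vn_entropy b (foldr (\<lambda>(p,\<rho>) acc. complex_of_real p \<cdot>\<^sub>m \<Phi> \<rho> + acc) E (0\<^sub>m k k))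
     - (\<Sum>(p,\<rho>)\<leftarrow>E. p * vn_entropy b (\<Phi> \<rho>))"

definition holevo :: "real \<Rightarrow> nat \<Rightarrow> nat \<Rightarrow> (complex mat \<Rightarrow> complex mat) \<Rightarrow> real" where
  "holevo b n k \<Phi> = Sup (holevo_value b k \<Phi> ` {E. ensemble n E})"

definition classical_capacity :: "real \<Rightarrow> nat \<Rightarrow> nat \<Rightarrow> (complex mat \<Rightarrow> complex mat) \<Rightarrow> real" where
  "classical_capacity b n k \<Phi> =
     lim (\<lambda>N. holevo b (n ^ N) (k ^ N) (channel_tpow \<Phi> n k N) / real N)"

definition onb_traceless :: "nat \<Rightarrow> complex mat list \<Rightarrow> bool" where
  "onb_traceless n Ms \<longleftrightarrow>
     length Ms = n\<^sup>2 - 1 \<and>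
     (\<forall>M \<in> set Ms. hermitian n M \<and> mtrace M = 0) \<and>
     (\<forall>i < length Ms. \<forall>j < length Ms. mtrace (Ms ! i * Ms ! j) = (if i = j then 1 else 0)) \<and>
     (\<forall>X. hermitian n X \<and> mtrace X = 0 \<longrightarrow>
        (\<exists>c :: nat \<Rightarrow> real. X = mat n n (\<lambda>ij. \<Sum>i<length Ms. complex_of_real (c i) * (Ms ! i $$ ij))))"

text \<open>(A_Phi)_{ij} = Tr[Phi(M_i) Phi(M_j)] (a real number, since the matrices are Hermitian)\<close>
definition A_mat :: "nat \<Rightarrow> (complex mat \<Rightarrow> complex mat) \<Rightarrow> real mat" where
  "A_mat n \<Phi> =
     (let Ms = (SOME Ms. onb_traceless n Ms)
      in mat (length Ms) (length Ms) (\<lambda>(i,j). Re (mtrace (\<Phi> (Ms ! i) * \<Phi> (Ms ! j)))))"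

text \<open>operator norm of a real square matrix w.r.t. the Euclidean norm (0 for the 0x0 matrix)\<close>
definition op_norm :: "real mat \<Rightarrow> real" where
  "op_norm A = Sup (insert 0 {sqrt (\<Sum>i<dim_row A. (\<Sum>j<dim_col A. A $$ (i,j) * v j)\<^sup>2) | v.
                       (\<Sum>j<dim_col A. (v j)\<^sup>2) = 1})"

definition gamma :: "nat \<Rightarrow> nat \<Rightarrow> (complex mat \<Rightarrow> complex mat) \<Rightarrow> real" where
  "gamma n k \<Phi> =
     (let a = op_norm (A_mat n \<Phi>)
      in if real n \<ge> real k * a then 1 / real k + (1 - 1 / real n) * a else a)"

end

theory Submission
  imports Defs "Jordan_Normal_Form.Spectral_Radius" "HOL-Analysis.L2_Norm"
begin

text \<open>Write \<open>a\<close> for the norm of \<open>A\<^sub>\<Phi>\<close>. Splitting off the trace part of a matrix \<open>Y\<close> and using that \<open>\<Phi>\<close>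
  is unital and trace preserving gives, in Hilbert-Schmidt norm,
  \<open>|\<Phi> Y|\<^sup>2 \<le> a |Y|\<^sup>2 + (1/k - a/n) |Tr Y|\<^sup>2\<close>. Applied blockwise to one tensor factor at a time, this
  bounds the output purity of \<open>\<Phi>\<close> to the \<open>N\<close>-th tensor power by \<open>\<gamma>(\<Phi>) ^ N\<close> (a negative second
  coefficient is simply dropped). The von Neumann entropy dominates the collision entropy
  \<open>- log Tr \<sigma>\<^sup>2\<close>, which bounds the minimal output entropy from below and, as an entropy
  is at most the logarithm of the dimension, the Holevo quantity from above. Product states and product
  ensembles make the two sequences sub- and superadditive, so both limits exist by Fekete's lemma.\<close>

subsection \<open>Block sums and unitary matrices\<close>

text \<open>What passes through tensor powers is the pair of coefficients of the one-factor bound.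
  Splitting off a factor turns the trace term into the output purity of a partially traced input,
  which is again a state, and the norm term into a purity with one more idle system. Both are
  estimated from above by the same induction hypothesis, so both coefficients must be nonnegative
  and their sum is the base of the power. The slices met on the way are not Hermitian, so the
  one-factor bound has to cover all complex matrices. Much of the remaining work makes the
  definitions usable. The spectrum in \<open>vn_entropy\<close> and the basis in
  \<open>A_mat\<close> are picked by \<open>SOME\<close>, so both must be shown to exist, and the
  entropy not to depend on the choice; \<open>Inf\<close> and \<open>Sup\<close> need nonempty
  bounded sets; \<open>lim\<close> says nothing without convergence. Complete positivity speaks only
  of identity maps tensored with the channel, so it is carried to tensor powers through Kraus
  operators.\<close>

lemma sum_lessThan_mult:
  fixes f :: "nat \<Rightarrow> 'a :: comm_monoid_add"
  shows "(\<Sum>x<a * b. f x) = (\<Sum>i<a. \<Sum>j<b. f (i * b + j))"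
proof -
  have "sum f {i * b..<i * b + b} = (\<Sum>j<b. f (i * b + j))" for i
    using sum.shift_bounds_nat_ivl[of f 0 "i * b" b]
    by (simp add: lessThan_atLeast0 add.commute)
  then show ?thesis
    by (simp add: sum.nat_group[symmetric])
qed

lemma sum_rotate:
  "(\<Sum>i\<in>A. \<Sum>j\<in>B. \<Sum>k\<in>C. f i j k) = (\<Sum>k\<in>C. \<Sum>i\<in>A. \<Sum>j\<in>B. f i j k)"
proof -
  have "(\<Sum>i\<in>A. \<Sum>j\<in>B. \<Sum>k\<in>C. f i j k) = (\<Sum>i\<in>A. \<Sum>k\<in>C. \<Sum>j\<in>B. f i j k)"
    by (rule sum.cong[OF refl], rule sum.swap)
  also have "\<dots> = (\<Sum>k\<in>C. \<Sum>i\<in>A. \<Sum>j\<in>B. f i j k)" by (rule sum.swap)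
  finally show ?thesis .
qed

lemma sum_swap_pairs:
  "(\<Sum>i\<in>A. \<Sum>j\<in>B. \<Sum>p\<in>C. \<Sum>q\<in>D. f i j p q) = (\<Sum>p\<in>C. \<Sum>q\<in>D. \<Sum>i\<in>A. \<Sum>j\<in>B. f i j p q)"
proof -
  have "(\<Sum>i\<in>A. \<Sum>j\<in>B. \<Sum>p\<in>C. \<Sum>q\<in>D. f i j p q) = (\<Sum>i\<in>A. \<Sum>p\<in>C. \<Sum>q\<in>D. \<Sum>j\<in>B. f i j p q)"
    by (rule sum.cong[OF refl], rule sum_rotate[symmetric])
  also have "\<dots> = (\<Sum>p\<in>C. \<Sum>q\<in>D. \<Sum>i\<in>A. \<Sum>j\<in>B. f i j p q)"
    by (rule sum_rotate[symmetric])
  finally show ?thesis .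
qed

text \<open>Fixed to type complex so that the simplifier reorders matrix entries but leaves index
  products such as \<open>i * m + p\<close> in the form that \<open>kron_index\<close>
  matches.\<close>

lemmas complex_mult_ac = mult.assoc[where 'a = complex] mult.commute[where 'a = complex]
  mult.left_commute[where 'a = complex]

lemma block_index_less:
  fixes i j a b :: nat
  assumes "i < a" "j < b"
  shows "i * b + j < a * b"
proof -
  have "i * b + j < Suc i * b" using assms by simp
  also have "\<dots> \<le> a * b" using assms by (intro mult_le_mono1) simp
  finally show ?thesis .
qed

lemma block_index_cases:
  fixes x a b :: nat
  assumes "x < a * b"
  obtains i j where "x = i * b + j" "i < a" "j < b"
proof
  show "x = x div b * b + x mod b" by simp
  show "x div b < a" using assms by (simp add: less_mult_imp_div_less)
  show "x mod b < b" using assms by (cases b) auto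
qed

section \<open>Entrywise forms of adjoints, unitarity and spectral decompositions\<close>

lemma adj_carrier [simp]: "A \<in> carrier_mat n m \<Longrightarrow> adj A \<in> carrier_mat m n"
  by (auto simp: adj_def)

lemma adj_dim [simp]: "dim_row (adj A) = dim_col A" "dim_col (adj A) = dim_row A"
  by (simp_all add: adj_def)

lemma adj_index [simp]: "i < dim_col A \<Longrightarrow> j < dim_row A \<Longrightarrow> adj A $$ (i,j) = cnj (A $$ (j,i))"
  by (simp add: adj_def)

lemma index_mult_sum:
  assumes "A \<in> carrier_mat n m" "B \<in> carrier_mat m l" "i < n" "j < l"
  shows "(A * B) $$ (i,j) = (\<Sum>p<m. A $$ (i,p) * B $$ (p,j))"
  using assms by (auto simp: scalar_prod_def lessThan_atLeast0 intro!: sum.cong)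

lemma hermitian_iff:
  "hermitian n A \<longleftrightarrow> A \<in> carrier_mat n n \<and> (\<forall>i<n. \<forall>j<n. cnj (A $$ (j,i)) = A $$ (i,j))"
proof
  assume H: "hermitian n A"
  then have A: "A \<in> carrier_mat n n" and e: "adj A = A" by (auto simp: hermitian_def)
  show "A \<in> carrier_mat n n \<and> (\<forall>i<n. \<forall>j<n. cnj (A $$ (j,i)) = A $$ (i,j))"
  proof (intro conjI allI impI A)
    fix i j assume "i < n" "j < n"
    then have "adj A $$ (i,j) = cnj (A $$ (j,i))" using A by simp
    then show "cnj (A $$ (j,i)) = A $$ (i,j)" using e by simp
  qed
next
  assume "A \<in> carrier_mat n n \<and> (\<forall>i<n. \<forall>j<n. cnj (A $$ (j,i)) = A $$ (i,j))"
  then show "hermitian n A" unfolding hermitian_def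
    by (auto intro!: eq_matI simp: adj_def)
qed

lemma unitary_iff:
  "unitary n U \<longleftrightarrow> U \<in> carrier_mat n n \<and>
     (\<forall>i<n. \<forall>j<n. (\<Sum>l<n. U $$ (i,l) * cnj (U $$ (j,l))) = (if i = j then 1 else 0))"
proof -
  have *: "(U * adj U) $$ (i,j) = (\<Sum>l<n. U $$ (i,l) * cnj (U $$ (j,l)))"
    if "U \<in> carrier_mat n n" "i < n" "j < n" for i j
    using that by (subst index_mult_sum[of _ n n _ n]) (auto intro!: sum.cong)
  show ?thesis
  proof
    assume "unitary n U"
    then have U: "U \<in> carrier_mat n n" and e: "U * adj U = 1\<^sub>m n" by (auto simp: unitary_def)
    show "U \<in> carrier_mat n n \<and>
      (\<forall>i<n. \<forall>j<n. (\<Sum>l<n. U $$ (i,l) * cnj (U $$ (j,l))) = (if i = j then 1 else 0))"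
      using U *[OF U] e by auto
  next
    assume a: "U \<in> carrier_mat n n \<and>
      (\<forall>i<n. \<forall>j<n. (\<Sum>l<n. U $$ (i,l) * cnj (U $$ (j,l))) = (if i = j then 1 else 0))"
    then have "U * adj U = 1\<^sub>m n"
      by (intro eq_matI) (auto simp: *)
    with a show "unitary n U" by (auto simp: unitary_def)
  qed
qed

text \<open>The definition gives orthonormal rows. For square matrices a right inverse is also a
  left inverse, so the columns are orthonormal too.\<close>

lemma unitary_left:
  assumes "unitary n U" "l < n" "m < n"
  shows "(\<Sum>i<n. cnj (U $$ (i,l)) * U $$ (i,m)) = (if l = m then 1 else 0)"
proof -
  have U: "U \<in> carrier_mat n n" and e: "U * adj U = 1\<^sub>m n"
    using assms by (auto simp: unitary_def)
  have "adj U * U = 1\<^sub>m n"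
    using mat_mult_left_right_inverse[OF U adj_carrier[OF U] e] .
  moreover have "(adj U * U) $$ (l,m) = (\<Sum>i<n. cnj (U $$ (i,l)) * U $$ (i,m))"
    using U assms by (subst index_mult_sum[of _ n n _ n]) (auto intro!: sum.cong)
  ultimately show ?thesis using assms by simp
qed

lemma spectral_decomp_iff:
  "spectral_decomp n A U d \<longleftrightarrow> unitary n U \<and> A \<in> carrier_mat n n \<and>
     (\<forall>i<n. \<forall>j<n. A $$ (i,j) = (\<Sum>l<n. U $$ (i,l) * of_real (d l) * cnj (U $$ (j,l))))"
proof -
  let ?D = "mat_diag n (\<lambda>i. complex_of_real (d i))"
  have *: "(U * ?D * adj U) $$ (i,j) = (\<Sum>l<n. U $$ (i,l) * of_real (d l) * cnj (U $$ (j,l)))"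
    if U: "U \<in> carrier_mat n n" and ij: "i < n" "j < n" for i j
  proof -
    have "(U * ?D * adj U) $$ (i,j) = (\<Sum>l<n. (U * ?D) $$ (i,l) * adj U $$ (l,j))"
      by (rule index_mult_sum[of _ n n _ n]) (use U ij in auto)
    also have "\<dots> = (\<Sum>l<n. U $$ (i,l) * of_real (d l) * cnj (U $$ (j,l)))"
      using U ij by (intro sum.cong) (auto simp: mat_diag_mult_right[OF U])
    finally show ?thesis .
  qed
  show ?thesis
  proof
    assume a: "spectral_decomp n A U d"
    then have u: "unitary n U" and A: "A = U * ?D * adj U" by (auto simp: spectral_decomp_def)
    have U: "U \<in> carrier_mat n n" using u by (simp add: unitary_def)
    have "A \<in> carrier_mat n n" unfolding A using U by (meson mult_carrier_mat mat_diag_dim adj_carrier)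
    then show "unitary n U \<and> A \<in> carrier_mat n n \<and>
      (\<forall>i<n. \<forall>j<n. A $$ (i,j) = (\<Sum>l<n. U $$ (i,l) * of_real (d l) * cnj (U $$ (j,l))))"
      using u *[OF U] A by auto
  next
    assume a: "unitary n U \<and> A \<in> carrier_mat n n \<and>
      (\<forall>i<n. \<forall>j<n. A $$ (i,j) = (\<Sum>l<n. U $$ (i,l) * of_real (d l) * cnj (U $$ (j,l))))"
    then have U: "U \<in> carrier_mat n n" by (simp add: unitary_def)
    have c: "U * ?D * adj U \<in> carrier_mat n n"
      using U by (meson mult_carrier_mat mat_diag_dim adj_carrier)
    have "A = U * ?D * adj U"
      by (rule eq_matI) (use a c U in \<open>auto simp del: index_mult_mat(1) simp: *[OF U]\<close>)
    with a show "spectral_decomp n A U d" by (simp add: spectral_decomp_def)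
  qed
qed

text \<open>The reflection \<open>1 - 2 w w\<^sup>* / |w|\<^sup>2\<close> with \<open>w = e\<^sub>0 - v\<close>, for which \<open>|w|\<^sup>2 = 2 (1 - v\<^sub>0)\<close>;
  it exchanges \<open>e\<^sub>0\<close> and \<open>v\<close>. If \<open>v = e\<^sub>0\<close> the division by zero yields the identity.\<close>

definition reflection :: "(nat \<Rightarrow> complex) \<Rightarrow> nat \<Rightarrow> nat \<Rightarrow> complex" where
  "reflection v p q = (if p = q then 1 else 0) -
     ((if p = 0 then 1 else 0) - v p) * cnj ((if q = 0 then 1 else 0) - v q) / (1 - v 0)"

context
  fixes n :: nat and v :: "nat \<Rightarrow> complex"
  assumes n: "n > 0" and v0: "cnj (v 0) = v 0" and v1: "(\<Sum>p<n. v p * cnj (v p)) = 1"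
begin

lemma reflection_sym: "cnj (reflection v p q) = reflection v q p"
  using v0 by (auto simp: reflection_def)

text \<open>A unit vector whose entry 0 is already 1 has no norm left for the other entries. This is
  what makes the division by zero in \<open>reflection\<close> harmless.\<close>

lemma reflection_degenerate:
  assumes "v 0 = 1" "0 < p" "p < n"
  shows "v p = 0"
proof -
  have "(\<Sum>p<n. v p * cnj (v p)) = v 0 * cnj (v 0) + (\<Sum>p\<in>{..<n} - {0}. v p * cnj (v p))"
    using n by (subst sum.remove[of _ 0]) auto
  then have "(\<Sum>p\<in>{..<n} - {0}. v p * cnj (v p)) = 0" using v1 assms by simp
  then have "of_real (\<Sum>p\<in>{..<n} - {0}. (cmod (v p))\<^sup>2) = (0::complex)"
    by (simp only: of_real_sum complex_norm_square)
  then have "(\<Sum>p\<in>{..<n} - {0}. (cmod (v p))\<^sup>2) = 0"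
    using of_real_eq_0_iff by blast
  then have "\<forall>p\<in>{..<n} - {0}. (cmod (v p))\<^sup>2 = 0"
    by (subst (asm) sum_nonneg_eq_0_iff) auto
  then show ?thesis using assms by auto
qed

lemma reflection_col_0:
  assumes "p < n"
  shows "reflection v p 0 = v p"
proof (cases "v 0 = 1")
  case True
  then show ?thesis using reflection_degenerate[of p] assms
    by (auto simp: reflection_def)
next
  case False
  then show ?thesis using v0 by (auto simp: reflection_def field_simps)
qed

lemma reflection_unitary:
  assumes "p < n" "q < n"
  shows "(\<Sum>l<n. reflection v p l * cnj (reflection v q l)) = (if p = q then 1 else 0)"
proof (cases "v 0 = 1")
  case True
  then have "(\<Sum>l<n. reflection v p l * cnj (reflection v q l))
      = (\<Sum>l<n. if l = p then (if p = q then 1 else 0) else 0)"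
    by (intro sum.cong) (auto simp: reflection_def)
  then show ?thesis using assms by simp
next
  case False
  define w where "w p = (if p = 0 then 1 else 0) - v p" for p :: nat
  define t where "t = 1 - v 0"
  have t: "t \<noteq> 0" "cnj t = t" using False v0 by (auto simp: t_def)
  have r: "reflection v p l = (if p = l then 1 else 0) - w p * cnj (w l) / t" for p l
    by (simp add: reflection_def w_def t_def)
  have "(\<Sum>l<n. w l * cnj (w l)) = (\<Sum>l<n. (if l = 0 then 1 - v 0 - cnj (v 0) else 0) + v l * cnj (v l))"
    by (rule sum.cong) (auto simp: w_def algebra_simps)
  also have "\<dots> = 2 * t"
    using n v0 v1 by (simp add: sum.distrib t_def)
  \<comment> \<open>With this value of the squared norm the quadratic term in the product below
    cancels the two cross terms.\<close>
  finally have w: "(\<Sum>l<n. cnj (w l) * w l) = 2 * t" by (simp add: mult.commute)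
  have "(\<Sum>l<n. reflection v p l * cnj (reflection v q l)) =
    (\<Sum>l<n. (if l = p then (if p = q then 1 else 0) else 0)
        - (if l = p then cnj (w q) * w p / t else 0)
        - (if l = q then w p * cnj (w q) / t else 0)
        + w p * cnj (w q) / t\<^sup>2 * (cnj (w l) * w l))"
    by (rule sum.cong) (auto simp: r t algebra_simps power2_eq_square)
  also have "\<dots> = (if p = q then 1 else 0) - cnj (w q) * w p / t - w p * cnj (w q) / t
      + w p * cnj (w q) / t\<^sup>2 * (2 * t)"
    using assms by (simp add: sum.distrib sum_subtractf del: times_divide_eq_left
      flip: sum_distrib_left) (simp add: w)
  also have "\<dots> = (if p = q then 1 else 0)"
    using t by (simp add: field_simps power2_eq_square)
  finally show ?thesis .
qed

end

subsection \<open>Spectral theorem\<close>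

lemma sum_mult_cnj_self:
  "(\<Sum>p\<in>S. f p * cnj (f p)) = complex_of_real (\<Sum>p\<in>S. (cmod (f p))\<^sup>2)"
  by (simp only: of_real_sum complex_norm_square)

text \<open>Besides norm 1, entry 0 is made real: \<open>reflection\<close> is self-adjoint and
  unitary only for such vectors, and an eigenvector may be multiplied by any phase.\<close>

lemma unit_eigenvector:
  assumes A: "A \<in> carrier_mat n n" and n: "n > 0"
  obtains e v where "cnj (v 0) = v 0" "(\<Sum>p<n. v p * cnj (v p)) = 1"
    "\<And>i. i < n \<Longrightarrow> (\<Sum>j<n. A $$ (i,j) * v j) = e * v i"
proof -
  obtain e where "eigenvalue A e"
    using spectrum_non_empty[OF A n] by (auto simp: spectrum_def)
  then obtain u where u: "u \<in> carrier_vec n" "u \<noteq> 0\<^sub>v n" and Au: "A *\<^sub>v u = e \<cdot>\<^sub>v u"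
    using A by (auto simp: eigenvalue_def eigenvector_def)
  have *: "(\<Sum>j<n. A $$ (i,j) * u $ j) = e * u $ i" if "i < n" for i
  proof -
    have "(A *\<^sub>v u) $ i = (\<Sum>j<n. A $$ (i,j) * u $ j)"
      using A u that by (auto simp: scalar_prod_def lessThan_atLeast0 intro!: sum.cong)
    then show ?thesis using Au u that by simp
  qed
  define s where "s = (\<Sum>p<n. (cmod (u $ p))\<^sup>2)"
  obtain p where p: "p < n" "u $ p \<noteq> 0" using u by (metis eq_vecI carrier_vecD index_zero_vec)
  have s: "s > 0" unfolding s_def using p by (intro sum_pos2[of _ p]) auto
  \<comment> \<open>The phase turns \<open>u $ 0\<close> into its modulus, and the division by
    \<open>sqrt s\<close> normalises.\<close>
  define c where "c = (if u $ 0 = 0 then 1 else cnj (u $ 0) / cmod (u $ 0)) / sqrt s"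
  have "(cmod c)\<^sup>2 = 1 / s"
    using s by (auto simp: c_def norm_divide power_divide)
  then have cc: "c * cnj c = 1 / s" by (metis complex_norm_square of_real_divide of_real_1)
  have "cnj (c * u $ 0) = c * u $ 0"
    by (auto simp: c_def)
  moreover have "(\<Sum>p<n. (c * u $ p) * cnj (c * u $ p)) = 1"
  proof -
    have "(\<Sum>p<n. (c * u $ p) * cnj (c * u $ p)) = c * cnj c * (\<Sum>p<n. u $ p * cnj (u $ p))"
      by (simp add: sum_distrib_left mult_ac)
    also have "(\<Sum>p<n. u $ p * cnj (u $ p)) = of_real s"
      unfolding s_def by (rule sum_mult_cnj_self)
    finally show ?thesis using s by (simp add: cc)
  qed
  moreover have "(\<Sum>j<n. A $$ (i,j) * (c * u $ j)) = e * (c * u $ i)" if "i < n" for i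
    using *[OF that, THEN arg_cong[where f = "\<lambda>x. c * x"]]
    by (simp add: sum_distrib_left mult_ac)
  ultimately show ?thesis by (rule that[of "\<lambda>i. c * u $ i"])
qed

text \<open>Deflation. The reflection \<open>R\<close> has a unit eigenvector as its column 0, so
  \<open>B\<close>, which is R A R, has only the entry \<open>e\<close> in column 0 and, being
  Hermitian, also in row 0. The induction hypothesis diagonalises the remaining block by
  \<open>V\<close>, and \<open>U\<close> is R times the direct sum of 1 and
  \<open>V\<close>.\<close>

theorem spectral_theorem:
  assumes "hermitian n A"
  shows "\<exists>U d. spectral_decomp n A U d"
  using assms
proof (induction n arbitrary: A)
  case 0
  then have "spectral_decomp 0 A (1\<^sub>m 0) (\<lambda>_. 0)"
    by (auto simp: spectral_decomp_iff unitary_iff hermitian_def)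
  then show ?case by blast
next
  case (Suc n A)
  let ?n = "Suc n"
  have A: "A \<in> carrier_mat ?n ?n" and hA: "\<And>i j. i < ?n \<Longrightarrow> j < ?n \<Longrightarrow> cnj (A $$ (j,i)) = A $$ (i,j)"
    using Suc.prems by (auto simp: hermitian_iff)
  obtain e v where v0: "cnj (v 0) = v 0" and v1: "(\<Sum>p<?n. v p * cnj (v p)) = 1"
    and ev: "\<And>i. i < ?n \<Longrightarrow> (\<Sum>j<?n. A $$ (i,j) * v j) = e * v i"
    by (rule unit_eigenvector[OF A zero_less_Suc]) (rule that)
  define R where "R = reflection v"
  have Rsym: "cnj (R p q) = R q p" for p q
    unfolding R_def using reflection_sym[of ?n v] v0 v1 by simp
  have R0: "R p 0 = v p" if "p < ?n" for p
    unfolding R_def using reflection_col_0[of ?n v] v0 v1 that by simp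
  have Ru: "(\<Sum>l<?n. R p l * R l q) = (if p = q then 1 else 0)" if "p < ?n" "q < ?n" for p q
    using reflection_unitary[of ?n v p q] v0 v1 that by (simp only: R_def[symmetric] Rsym)
  define B where "B i j = (\<Sum>p<?n. \<Sum>q<?n. R i p * A $$ (p,q) * R q j)" for i j
  have Bh: "cnj (B j i) = B i j" for i j
  proof -
    have "cnj (B j i) = (\<Sum>p<?n. \<Sum>q<?n. R p j * A $$ (q,p) * R i q)"
      unfolding B_def cnj_sum complex_cnj_mult Rsym
      by (intro sum.cong) (auto simp: hA)
    also have "\<dots> = B i j"
      unfolding B_def by (subst sum.swap) (intro sum.cong refl, simp only: mult_ac)
    finally show ?thesis .
  qed
  have B0: "B i 0 = (if i = 0 then e else 0)" if "i < ?n" for i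
  proof -
    have "B i 0 = (\<Sum>p<?n. R i p * (\<Sum>q<?n. A $$ (p,q) * v q))"
      unfolding B_def sum_distrib_left by (intro sum.cong refl) (auto simp: R0 mult_ac)
    also have "\<dots> = (\<Sum>p<?n. R i p * (e * R p 0))"
      by (intro sum.cong refl) (auto simp del: sum.lessThan_Suc simp: ev R0)
    also have "\<dots> = e * (\<Sum>p<?n. R i p * R p 0)"
      unfolding sum_distrib_left by (intro sum.cong) (auto simp: mult_ac)
    finally show ?thesis using Ru[OF that, of 0] by simp
  qed
  have ereal: "e = of_real (Re e)" using Bh[of 0 0] B0[of 0] by (simp add: complex_eq_iff)
  define A3 where "A3 = mat n n (\<lambda>(i,j). B (Suc i) (Suc j))"
  have "hermitian n A3" by (auto simp: hermitian_iff A3_def Bh)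
  from Suc.IH[OF this] obtain V d where Vd: "spectral_decomp n A3 V d" by blast
  then have V: "V \<in> carrier_mat n n"
    and Vu: "\<And>i j. i < n \<Longrightarrow> j < n \<Longrightarrow> (\<Sum>l<n. V $$ (i,l) * cnj (V $$ (j,l))) = (if i = j then 1 else 0)"
    and VA: "\<And>i j. i < n \<Longrightarrow> j < n \<Longrightarrow> B (Suc i) (Suc j) = (\<Sum>l<n. V $$ (i,l) * of_real (d l) * cnj (V $$ (j,l)))"
    by (auto simp: spectral_decomp_iff unitary_iff A3_def)
  define W where "W i j = (case (i,j) of (0,0) \<Rightarrow> 1 | (Suc i, Suc j) \<Rightarrow> V $$ (i,j) | _ \<Rightarrow> 0)" for i j
  have W [simp]: "W 0 0 = 1" "W (Suc i) 0 = 0" "W 0 (Suc j) = 0" "W (Suc i) (Suc j) = V $$ (i,j)" for i j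
    by (simp_all add: W_def)
  define f where "f = case_nat (Re e) d"
  have f [simp]: "f 0 = Re e" "f (Suc i) = d i" for i by (simp_all add: f_def)
  have Wu: "(\<Sum>l<?n. W i l * cnj (W j l)) = (if i = j then 1 else 0)" if "i < ?n" "j < ?n" for i j
    using that by (cases i; cases j) (simp_all add: sum.lessThan_Suc_shift Vu del: sum.lessThan_Suc)
  have WB: "B i j = (\<Sum>l<?n. W i l * of_real (f l) * cnj (W j l))" if "i < ?n" "j < ?n" for i j
  proof -
    have "B 0 (Suc m) = 0" if "Suc m < ?n" for m using Bh[of "Suc m" 0] B0[OF that] by simp
    then show ?thesis
      using that ereal
      by (cases i; cases j) (simp_all add: sum.lessThan_Suc_shift B0 VA del: sum.lessThan_Suc)
  qed
  have RBR: "(\<Sum>i<?n. \<Sum>j<?n. R x i * B i j * R j y) = A $$ (x,y)" if "x < ?n" "y < ?n" for x y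
  proof -
    have "(\<Sum>i<?n. \<Sum>j<?n. R x i * B i j * R j y) =
        (\<Sum>i<?n. \<Sum>j<?n. \<Sum>p<?n. \<Sum>q<?n. (R x i * R i p) * A $$ (p,q) * (R q j * R j y))"
      unfolding B_def sum_distrib_left sum_distrib_right by (intro sum.cong refl) (simp only: mult_ac)
    also have "\<dots> = (\<Sum>p<?n. \<Sum>q<?n. \<Sum>i<?n. \<Sum>j<?n. (R x i * R i p) * A $$ (p,q) * (R q j * R j y))"
      by (rule sum_swap_pairs)
    also have "\<dots> = (\<Sum>p<?n. \<Sum>q<?n. (\<Sum>i<?n. R x i * R i p) * A $$ (p,q) * (\<Sum>j<?n. R q j * R j y))"
      by (intro sum.cong refl) (subst sum.swap, simp only: sum_distrib_left sum_distrib_right)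
    also have "\<dots> = (\<Sum>p<?n. \<Sum>q<?n. if q = y then if p = x then A $$ (x,y) else 0 else 0)"
      using that by (intro sum.cong refl) (auto simp: Ru simp del: sum.lessThan_Suc)
    also have "\<dots> = A $$ (x,y)"
      using that by (simp add: sum.delta del: sum.lessThan_Suc)
    finally show ?thesis .
  qed
  define U where "U = mat ?n ?n (\<lambda>(i,j). \<Sum>p<?n. R i p * W p j)"
  \<comment> \<open>Used twice: with \<open>g\<close> constantly 1 it reduces unitarity of
    \<open>U\<close> to that of \<open>W\<close>, and with the eigenvalues for \<open>g\<close> it
    reduces the decomposition of \<open>A\<close> to that of \<open>B\<close>.\<close>
  have prodsum: "(\<Sum>l<?n. U $$ (x,l) * g l * cnj (U $$ (y,l))) =
     (\<Sum>i<?n. \<Sum>j<?n. R x i * (\<Sum>l<?n. W i l * g l * cnj (W j l)) * R j y)"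
    if "x < ?n" "y < ?n" for x y g
  proof -
    have "(\<Sum>l<?n. U $$ (x,l) * g l * cnj (U $$ (y,l))) =
       (\<Sum>l<?n. \<Sum>i<?n. \<Sum>j<?n. R x i * (W i l * g l * cnj (W j l)) * R j y)"
    proof (intro sum.cong refl)
      fix l assume l: "l \<in> {..<?n}"
      have Ux: "U $$ (x,l) = (\<Sum>i<?n. R x i * W i l)"
        using that l by (simp add: U_def del: sum.lessThan_Suc)
      have Uy: "cnj (U $$ (y,l)) = (\<Sum>j<?n. cnj (W j l) * R j y)"
        using that l by (simp add: U_def Rsym mult.commute del: sum.lessThan_Suc)
      have "U $$ (x,l) * g l * cnj (U $$ (y,l)) = (\<Sum>i<?n. R x i * W i l * g l) * (\<Sum>j<?n. cnj (W j l) * R j y)"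
        by (simp only: Ux Uy sum_distrib_right)
      also have "\<dots> = (\<Sum>i<?n. \<Sum>j<?n. R x i * (W i l * g l * cnj (W j l)) * R j y)"
        unfolding sum_product by (intro sum.cong refl) (simp only: mult_ac)
      finally show "U $$ (x,l) * g l * cnj (U $$ (y,l)) = \<dots>" .
    qed
    also have "\<dots> = (\<Sum>i<?n. \<Sum>j<?n. \<Sum>l<?n. R x i * (W i l * g l * cnj (W j l)) * R j y)"
      by (rule sum_rotate[symmetric])
    finally show ?thesis by (simp only: sum_distrib_left sum_distrib_right)
  qed
  have "unitary ?n U"
    unfolding unitary_iff
  proof (intro conjI allI impI)
    show "U \<in> carrier_mat ?n ?n" by (simp add: U_def)
    fix x y assume xy: "x < ?n" "y < ?n"
    have "(\<Sum>l<?n. U $$ (x,l) * cnj (U $$ (y,l))) =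
      (\<Sum>i<?n. \<Sum>j<?n. R x i * (\<Sum>l<?n. W i l * cnj (W j l)) * R j y)"
      using prodsum[OF xy, of "\<lambda>_. 1"] by (simp only: mult_1_right)
    also have "\<dots> = (\<Sum>i<?n. \<Sum>j<?n. if j = i then R x i * R i y else 0)"
      by (intro sum.cong refl) (auto simp: Wu simp del: sum.lessThan_Suc)
    also have "\<dots> = (\<Sum>i<?n. R x i * R i y)"
      by (intro sum.cong refl) (simp del: sum.lessThan_Suc)
    finally show "(\<Sum>l<?n. U $$ (x,l) * cnj (U $$ (y,l))) = (if x = y then 1 else 0)"
      using Ru[OF xy] by simp
  qed
  moreover have "A $$ (x,y) = (\<Sum>l<?n. U $$ (x,l) * of_real (f l) * cnj (U $$ (y,l)))"
    if xy: "x < ?n" "y < ?n" for x y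
    unfolding prodsum[OF xy] RBR[OF xy, symmetric] by (intro sum.cong refl) (simp only: WB lessThan_iff)
  ultimately have "spectral_decomp ?n A U f"
    using A by (auto simp: spectral_decomp_iff simp del: sum.lessThan_Suc)
  then show ?case by blast
qed

subsection \<open>Entropy and positive semidefinite matrices\<close>

lemma spectral_decomp_carrier:
  assumes "spectral_decomp n A U d"
  shows "A \<in> carrier_mat n n" "U \<in> carrier_mat n n" "unitary n U"
  using assms by (auto simp: spectral_decomp_iff unitary_iff)

lemma spectral_eigen:
  assumes "spectral_decomp n A U d" "p < n" "j < n"
  shows "(\<Sum>q<n. A $$ (p,q) * U $$ (q,j)) = of_real (d j) * U $$ (p,j)"
proof -
  have "(\<Sum>q<n. A $$ (p,q) * U $$ (q,j)) =
      (\<Sum>q<n. \<Sum>l<n. U $$ (p,l) * of_real (d l) * (cnj (U $$ (q,l)) * U $$ (q,j)))"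
    using assms by (intro sum.cong) (auto simp: spectral_decomp_iff sum_distrib_right sum_distrib_left mult_ac)
  also have "\<dots> = (\<Sum>l<n. U $$ (p,l) * of_real (d l) * (\<Sum>q<n. cnj (U $$ (q,l)) * U $$ (q,j)))"
    by (subst sum.swap) (simp only: sum_distrib_left)
  also have "\<dots> = (\<Sum>l<n. if l = j then U $$ (p,l) * of_real (d l) else 0)"
    using assms spectral_decomp_carrier(3)[OF assms(1)]
    by (intro sum.cong) (auto simp: unitary_left)
  finally show ?thesis using assms by simp
qed

lemma spectral_trace:
  assumes "spectral_decomp n A U d"
  shows "mtrace A = of_real (\<Sum>l<n. d l)"
proof -
  have "mtrace A = (\<Sum>i<n. \<Sum>l<n. of_real (d l) * (cnj (U $$ (i,l)) * U $$ (i,l)))"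
    using assms spectral_decomp_carrier(1)[OF assms] unfolding mtrace_def
    by (intro sum.cong) (auto simp: spectral_decomp_iff mult_ac)
  also have "\<dots> = (\<Sum>l<n. of_real (d l) * (\<Sum>i<n. cnj (U $$ (i,l)) * U $$ (i,l)))"
    by (subst sum.swap) (simp only: sum_distrib_left)
  also have "\<dots> = (\<Sum>l<n. of_real (d l))"
    using spectral_decomp_carrier(3)[OF assms] by (intro sum.cong) (auto simp: unitary_left)
  finally show ?thesis by simp
qed

text \<open>The adjoint of \<open>V\<close> is an isometry. Applied to the columns of another
  unitary matrix, this evaluates the row and column sums of squared overlaps.\<close>

lemma unitary_norm:
  assumes "unitary n V"
  shows "(\<Sum>i<n. (\<Sum>p<n. cnj (V $$ (p,i)) * x p) * cnj (\<Sum>p<n. cnj (V $$ (p,i)) * x p))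
    = (\<Sum>p<n. x p * cnj (x p))"
proof -
  have "(\<Sum>i<n. (\<Sum>p<n. cnj (V $$ (p,i)) * x p) * cnj (\<Sum>p<n. cnj (V $$ (p,i)) * x p))
    = (\<Sum>i<n. \<Sum>p<n. \<Sum>q<n. x p * cnj (x q) * (V $$ (q,i) * cnj (V $$ (p,i))))"
    unfolding cnj_sum sum_product by (intro sum.cong refl) (simp add: mult_ac)
  also have "\<dots> = (\<Sum>p<n. \<Sum>q<n. \<Sum>i<n. x p * cnj (x q) * (V $$ (q,i) * cnj (V $$ (p,i))))"
    by (rule sum_rotate[symmetric])
  also have "\<dots> = (\<Sum>p<n. \<Sum>q<n. x p * cnj (x q) * (\<Sum>i<n. V $$ (q,i) * cnj (V $$ (p,i))))"
    by (simp only: sum_distrib_left)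
  also have "\<dots> = (\<Sum>p<n. \<Sum>q<n. if q = p then x p * cnj (x p) else 0)"
    using assms by (intro sum.cong) (auto simp: unitary_iff)
  finally show ?thesis by simp
qed

text \<open>The overlaps \<open>W\<close> of the two eigenbases are nonzero only between equal
  eigenvalues, and their squared moduli form a doubly stochastic matrix. Averaging \<open>f\<close>
  with this matrix turns one sum into the other, without sorting eigenvalues or counting
  multiplicities.\<close>

lemma spectral_decomp_sum_unique:
  fixes f :: "real \<Rightarrow> real"
  assumes U: "spectral_decomp n A U d" and V: "spectral_decomp n A V e"
  shows "(\<Sum>i<n. f (d i)) = (\<Sum>i<n. f (e i))"
proof -
  note u = spectral_decomp_carrier[OF U] and v = spectral_decomp_carrier[OF V]
  define W where "W i j = (\<Sum>p<n. cnj (V $$ (p,i)) * U $$ (p,j))" for i j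
  have herm: "cnj (A $$ (p,q)) = A $$ (q,p)" if "p < n" "q < n" for p q
    using U that by (auto simp: spectral_decomp_iff intro!: sum.cong)
  \<comment> \<open>The matrix element of \<open>A\<close> between the two eigenvectors, computed
    once by letting \<open>A\<close> act to the right and once to the left.\<close>
  have inter: "W i j * of_real (d j) = of_real (e i) * W i j" if ij: "i < n" "j < n" for i j
  proof -
    have "W i j * of_real (d j) = (\<Sum>p<n. cnj (V $$ (p,i)) * (\<Sum>q<n. A $$ (p,q) * U $$ (q,j)))"
      unfolding W_def sum_distrib_right using ij by (intro sum.cong) (auto simp: spectral_eigen[OF U])
    also have "\<dots> = (\<Sum>q<n. cnj (\<Sum>p<n. A $$ (q,p) * V $$ (p,i)) * U $$ (q,j))"
      unfolding sum_distrib_left cnj_sum sum_distrib_right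
      by (subst sum.swap) (intro sum.cong refl, simp add: herm mult_ac)
    also have "\<dots> = of_real (e i) * W i j"
      unfolding W_def sum_distrib_left using ij
      by (intro sum.cong) (auto simp: spectral_eigen[OF V] mult_ac)
    finally show ?thesis .
  qed
  have same: "(cmod (W i j))\<^sup>2 * f (d j) = (cmod (W i j))\<^sup>2 * f (e i)" if "i < n" "j < n" for i j
  proof (cases "W i j = 0")
    case False
    then have "complex_of_real (d j) = of_real (e i)" using inter[OF that] by simp
    then show ?thesis by simp
  qed simp
  have col: "(\<Sum>i<n. (cmod (W i j))\<^sup>2) = 1" if "j < n" for j
  proof -
    have "complex_of_real (\<Sum>i<n. (cmod (W i j))\<^sup>2) = (\<Sum>p<n. U $$ (p,j) * cnj (U $$ (p,j)))"
      unfolding sum_mult_cnj_self[symmetric] W_def by (rule unitary_norm[OF v(3)])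
    also have "\<dots> = 1" using unitary_left[OF u(3) that that] by (simp add: mult.commute)
    finally show ?thesis by (simp only: of_real_eq_1_iff)
  qed
  have row: "(\<Sum>j<n. (cmod (W i j))\<^sup>2) = 1" if "i < n" for i
  proof -
    have "cmod (W i j) = cmod (\<Sum>p<n. cnj (U $$ (p,j)) * V $$ (p,i))" for j
      by (subst complex_mod_cnj[symmetric]) (simp add: W_def mult.commute)
    then have "complex_of_real (\<Sum>j<n. (cmod (W i j))\<^sup>2) = (\<Sum>p<n. V $$ (p,i) * cnj (V $$ (p,i)))"
      by (simp only: sum_mult_cnj_self[symmetric] unitary_norm[OF u(3)])
    also have "\<dots> = 1" using unitary_left[OF v(3) that that] by (simp add: mult.commute)
    finally show ?thesis by (simp only: of_real_eq_1_iff)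
  qed
  have "(\<Sum>j<n. f (d j)) = (\<Sum>j<n. \<Sum>i<n. (cmod (W i j))\<^sup>2 * f (d j))"
    by (intro sum.cong refl) (simp add: col flip: sum_distrib_right)
  also have "\<dots> = (\<Sum>i<n. \<Sum>j<n. (cmod (W i j))\<^sup>2 * f (e i))"
    by (subst sum.swap) (intro sum.cong refl, simp add: same)
  also have "\<dots> = (\<Sum>i<n. f (e i))"
    by (intro sum.cong refl) (simp add: row flip: sum_distrib_right)
  finally show ?thesis .
qed

lemma vn_entropy_spectral:
  assumes "spectral_decomp n A U d"
  shows "vn_entropy b A = - (\<Sum>i<n. d i * log b (d i))"
proof -
  have n: "dim_row A = n" using spectral_decomp_carrier[OF assms] by auto
  define e where "e = (SOME d. \<exists>U. spectral_decomp n A U d)"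
  have "\<exists>U. spectral_decomp n A U e"
    unfolding e_def using someI_ex[of "\<lambda>d. \<exists>U. spectral_decomp n A U d"] assms by blast
  then have "(\<Sum>i<n. e i * log b (e i)) = (\<Sum>i<n. d i * log b (d i))"
    using spectral_decomp_sum_unique[OF _ assms, of _ e "\<lambda>x. x * log b x"] by blast
  then show ?thesis by (simp add: vn_entropy_def Let_def n flip: e_def)
qed

text \<open>The squared Hilbert-Schmidt norm. For a state it is the purity, but it is also applied
  to non-Hermitian blocks, where the trace of the square would be the wrong quantity.\<close>

definition hs :: "complex mat \<Rightarrow> real" where
  "hs A = (\<Sum>i<dim_row A. \<Sum>j<dim_col A. (cmod (A $$ (i,j)))\<^sup>2)"

lemma spectral_hs:
  assumes "spectral_decomp n A U d"
  shows "hs A = (\<Sum>l<n. (d l)\<^sup>2)"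
proof -
  note A = spectral_decomp_carrier[OF assms]
  have herm: "cnj (A $$ (p,q)) = A $$ (q,p)" if "p < n" "q < n" for p q
    using assms that by (auto simp: spectral_decomp_iff intro!: sum.cong)
  have "complex_of_real (hs A) = (\<Sum>i<n. \<Sum>j<n. A $$ (i,j) * cnj (A $$ (i,j)))"
    using A by (simp add: hs_def sum_mult_cnj_self)
  \<comment> \<open>Only the conjugated entry is expanded, so that the other copy of
    \<open>A\<close> can act on an eigenvector.\<close>
  also have "\<dots> = (\<Sum>i<n. \<Sum>j<n. \<Sum>l<n. A $$ (i,j) * U $$ (j,l) * of_real (d l) * cnj (U $$ (i,l)))"
    using assms by (intro sum.cong refl)
      (simp add: herm, simp add: spectral_decomp_iff sum_distrib_left mult_ac)
  also have "\<dots> = (\<Sum>i<n. \<Sum>l<n. (\<Sum>j<n. A $$ (i,j) * U $$ (j,l)) * of_real (d l) * cnj (U $$ (i,l)))"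
    unfolding sum_distrib_right by (rule sum.cong[OF refl], rule sum.swap)
  also have "\<dots> = (\<Sum>l<n. \<Sum>i<n. of_real ((d l)\<^sup>2) * (cnj (U $$ (i,l)) * U $$ (i,l)))"
    by (subst sum.swap) (intro sum.cong refl, simp add: spectral_eigen[OF assms] power2_eq_square)
  also have "\<dots> = (\<Sum>l<n. of_real ((d l)\<^sup>2))"
    by (intro sum.cong refl) (simp add: unitary_left[OF A(3)] flip: sum_distrib_left)
  finally show ?thesis by (simp only: of_real_sum[symmetric] of_real_eq_iff)
qed

section \<open>Positive semidefinite matrices as Gram matrices\<close>

lemma psd_iff_form:
  "psd n A \<longleftrightarrow> hermitian n A \<and> (\<forall>x. 0 \<le> Re (\<Sum>i<n. \<Sum>j<n. cnj (x i) * A $$ (i,j) * x j))"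
proof -
  have *: "map_vec cnj (vec n x) \<bullet> (A *\<^sub>v vec n x) = (\<Sum>i<n. \<Sum>j<n. cnj (x i) * A $$ (i,j) * x j)"
    if "A \<in> carrier_mat n n" for x
    using that
    by (auto simp: scalar_prod_def lessThan_atLeast0 sum_distrib_left mult.assoc intro!: sum.cong)
  have **: "vec n (\<lambda>i. v $ i) = v" if "v \<in> carrier_vec n" for v :: "complex vec"
    using that by auto
  show ?thesis
  proof
    assume p: "psd n A"
    then have A: "A \<in> carrier_mat n n" by (simp add: psd_def hermitian_def)
    have "0 \<le> Re (\<Sum>i<n. \<Sum>j<n. cnj (x i) * A $$ (i,j) * x j)" for x
      using p *[OF A, of x] by (auto simp: psd_def dest!: bspec[of _ _ "vec n x"])
    then show "hermitian n A \<and> (\<forall>x. 0 \<le> Re (\<Sum>i<n. \<Sum>j<n. cnj (x i) * A $$ (i,j) * x j))"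
      using p by (simp add: psd_def)
  next
    assume a: "hermitian n A \<and> (\<forall>x. 0 \<le> Re (\<Sum>i<n. \<Sum>j<n. cnj (x i) * A $$ (i,j) * x j))"
    then have A: "A \<in> carrier_mat n n" by (simp add: hermitian_def)
    show "psd n A" unfolding psd_def
    proof (intro conjI ballI)
      fix v :: "complex vec" assume v: "v \<in> carrier_vec n"
      show "0 \<le> Re (map_vec cnj v \<bullet> (A *\<^sub>v v))"
        using a *[OF A, of "\<lambda>i. v $ i"] **[OF v] by simp
    qed (use a in blast)
  qed
qed

lemma psd_eigenvalue_nonneg:
  assumes "psd n A" and U: "spectral_decomp n A U d" and l: "l < n"
  shows "d l \<ge> 0"
proof -
  have "(\<Sum>i<n. \<Sum>j<n. cnj (U $$ (i,l)) * A $$ (i,j) * U $$ (j,l)) =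
    (\<Sum>i<n. cnj (U $$ (i,l)) * (\<Sum>j<n. A $$ (i,j) * U $$ (j,l)))"
    by (simp add: sum_distrib_left mult.assoc)
  also have "\<dots> = (\<Sum>i<n. of_real (d l) * (cnj (U $$ (i,l)) * U $$ (i,l)))"
    using l by (intro sum.cong refl) (simp add: spectral_eigen[OF U])
  also have "\<dots> = of_real (d l) * (\<Sum>i<n. cnj (U $$ (i,l)) * U $$ (i,l))"
    by (simp only: sum_distrib_left)
  also have "\<dots> = of_real (d l)"
    by (simp add: unitary_left[OF spectral_decomp_carrier(3)[OF U] l l])
  finally have form: "(\<Sum>i<n. \<Sum>j<n. cnj (U $$ (i,l)) * A $$ (i,j) * U $$ (j,l)) = of_real (d l)" .
  have "\<forall>x. 0 \<le> Re (\<Sum>i<n. \<Sum>j<n. cnj (x i) * A $$ (i,j) * x j)"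
    using assms(1) unfolding psd_iff_form by blast
  from this[rule_format, of "\<lambda>i. U $$ (i,l)"] show ?thesis
    by (simp only: form Re_complex_of_real)
qed

text \<open>The number \<open>L\<close> of Gram columns is free. Positivity of products, partial
  traces and channel outputs is thus proved by exhibiting the columns.\<close>

lemma psd_gramI:
  assumes A: "A \<in> carrier_mat n n"
    and G: "\<And>i j. i < n \<Longrightarrow> j < n \<Longrightarrow> A $$ (i,j) = (\<Sum>l<L. B i l * cnj (B j l))"
  shows "psd n A"
  unfolding psd_iff_form
proof (intro conjI allI)
  show "hermitian n A" using A by (auto simp: hermitian_iff G mult.commute)
  fix x
  have "(\<Sum>i<n. \<Sum>j<n. cnj (x i) * A $$ (i,j) * x j) =
     (\<Sum>i<n. \<Sum>j<n. \<Sum>l<L. (cnj (x i) * B i l) * (cnj (B j l) * x j))"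
    by (intro sum.cong refl) (simp add: G sum_distrib_left sum_distrib_right mult.assoc)
  also have "\<dots> = (\<Sum>l<L. \<Sum>i<n. \<Sum>j<n. (cnj (x i) * B i l) * (cnj (B j l) * x j))"
    by (rule sum_rotate)
  also have "\<dots> = (\<Sum>l<L. (\<Sum>i<n. cnj (x i) * B i l) * cnj (\<Sum>i<n. cnj (x i) * B i l))"
    unfolding cnj_sum sum_product by (intro sum.cong refl) (simp add: mult_ac)
  also have "\<dots> = of_real (\<Sum>l<L. (cmod (\<Sum>i<n. cnj (x i) * B i l))\<^sup>2)"
    by (rule sum_mult_cnj_self)
  finally show "0 \<le> Re (\<Sum>i<n. \<Sum>j<n. cnj (x i) * A $$ (i,j) * x j)"
    by (simp add: sum_nonneg del: of_real_sum)
qed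

text \<open>The Gram columns are the eigenvectors scaled by the square roots of the
  eigenvalues.\<close>

lemma psd_gramE:
  assumes "psd n A"
  obtains B :: "nat \<Rightarrow> nat \<Rightarrow> complex"
    where "\<And>i j. i < n \<Longrightarrow> j < n \<Longrightarrow> A $$ (i,j) = (\<Sum>l<n. B i l * cnj (B j l))"
proof -
  obtain U d where U: "spectral_decomp n A U d"
    using spectral_theorem[of n A] assms by (auto simp: psd_def)
  define B where "B i l = U $$ (i,l) * of_real (sqrt (d l))" for i l
  have "A $$ (i,j) = (\<Sum>l<n. B i l * cnj (B j l))" if ij: "i < n" "j < n" for i j
  proof -
    have "B i l * cnj (B j l) = U $$ (i,l) * of_real (d l) * cnj (U $$ (j,l))" if "l < n" for l
    proof -
      have "complex_of_real (d l) = of_real (sqrt (d l)) * of_real (sqrt (d l))"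
        using psd_eigenvalue_nonneg[OF assms U that] by (simp flip: of_real_mult)
      then show ?thesis by (simp add: B_def mult_ac)
    qed
    then show ?thesis using U ij by (simp add: spectral_decomp_iff)
  qed
  then show ?thesis by (rule that)
qed

lemma psd_carrier: "psd n A \<Longrightarrow> A \<in> carrier_mat n n"
  by (simp add: psd_def hermitian_def)

lemma density_carrier: "density n A \<Longrightarrow> A \<in> carrier_mat n n"
  by (simp add: density_def psd_carrier)

section \<open>Spectra of states and entropy bounds\<close>

lemma density_spectralE:
  assumes "density n A"
  obtains U d where "spectral_decomp n A U d" "\<And>l. l < n \<Longrightarrow> d l \<ge> 0" "(\<Sum>l<n. d l) = 1"
proof -
  have p: "psd n A" and t: "mtrace A = 1" using assms by (auto simp: density_def)
  obtain U d where U: "spectral_decomp n A U d"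
    using spectral_theorem[of n A] p by (auto simp: psd_def)
  have "complex_of_real (\<Sum>l<n. d l) = 1" using spectral_trace[OF U] t by simp
  then have "(\<Sum>l<n. d l) = 1" by (simp only: of_real_eq_1_iff)
  then show ?thesis using that[OF U] psd_eigenvalue_nonneg[OF p U] by blast
qed

lemma density_hs_le_1:
  assumes "density n A"
  shows "hs A \<le> 1"
proof -
  obtain U d where U: "spectral_decomp n A U d" and d: "\<And>l. l < n \<Longrightarrow> d l \<ge> 0" "(\<Sum>l<n. d l) = 1"
    using density_spectralE[OF assms] by metis
  have "(\<Sum>l<n. (d l)\<^sup>2) \<le> (\<Sum>l<n. d l * 1)"
    unfolding power2_eq_square
  proof (intro sum_mono mult_left_mono)
    fix l assume l: "l \<in> {..<n}"
    show "d l \<le> 1" using member_le_sum[of l "{..<n}" d] d l by auto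
  qed (use d in auto)
  then show ?thesis using d by (simp add: spectral_hs[OF U])
qed

lemma density_hs_pos:
  assumes "density n A"
  shows "hs A > 0"
proof (rule ccontr)
  obtain U d where U: "spectral_decomp n A U d" and d: "(\<Sum>l<n. d l) = 1"
    using density_spectralE[OF assms] by metis
  assume "\<not> hs A > 0"
  then have "(\<Sum>l<n. (d l)\<^sup>2) = 0"
    using spectral_hs[OF U] by (simp add: order_antisym sum_nonneg)
  then have "\<forall>l<n. d l = 0"
    by (subst (asm) sum_nonneg_eq_0_iff) auto
  then show False using d by simp
qed

text \<open>Jensen's inequality for the logarithm in tangent form: ln (x / s) <= x / s - 1 with
  \<open>s\<close> the purity, weighted by the eigenvalues. The corrections sum to s / s - 1 =
  0.\<close>

lemma entropy_ge_collision:
  assumes b: "b > 1" and "density n A"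
  shows "vn_entropy b A \<ge> - log b (hs A)"
proof -
  obtain U d where U: "spectral_decomp n A U d" and d: "\<And>l. l < n \<Longrightarrow> d l \<ge> 0" "(\<Sum>l<n. d l) = 1"
    using density_spectralE[OF assms(2)] by metis
  define s where "s = hs A"
  have s: "s > 0" using density_hs_pos[OF assms(2)] by (simp add: s_def)
  have "d l * ln (d l) \<le> d l * ln s + ((d l)\<^sup>2 / s - d l)" if l: "l < n" for l
  proof (cases "d l = 0")
    case False
    then have pos: "d l > 0" using d l by (simp add: order_less_le)
    have "ln (d l / s) \<le> d l / s - 1" using pos s by (intro ln_le_minus_one) simp
    then have "ln (d l) \<le> ln s + (d l / s - 1)" using pos s by (simp add: ln_div)
    then have "d l * ln (d l) \<le> d l * (ln s + (d l / s - 1))" using pos by (intro mult_left_mono) auto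
    then show ?thesis by (simp add: algebra_simps power2_eq_square)
  qed simp
  then have "(\<Sum>l<n. d l * ln (d l)) \<le> (\<Sum>l<n. d l * ln s + ((d l)\<^sup>2 / s - d l))"
    by (intro sum_mono) auto
  also have "\<dots> = ln s"
    using d s spectral_hs[OF U] s_def
    by (simp add: sum.distrib sum_subtractf flip: sum_distrib_right sum_divide_distrib)
  finally have "(\<Sum>l<n. d l * log b (d l)) \<le> log b s"
    using b by (simp add: log_def divide_right_mono flip: sum_divide_distrib)
  then show ?thesis by (simp add: vn_entropy_spectral[OF U] s_def)
qed

text \<open>The same tangent inequality at 1 / (n x). Here the corrections 1 / n - x sum to 0, and a
  zero eigenvalue merely leaves a surplus of 1 / n.\<close>

lemma entropy_le_log_dim:
  assumes b: "b > 1" and "density n A" and n: "n > 0"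
  shows "vn_entropy b A \<le> log b (real n)"
proof -
  obtain U d where U: "spectral_decomp n A U d" and d: "\<And>l. l < n \<Longrightarrow> d l \<ge> 0" "(\<Sum>l<n. d l) = 1"
    using density_spectralE[OF assms(2)] by metis
  have "- (d l * ln (d l)) \<le> d l * ln n + (1 / n - d l)" if l: "l < n" for l
  proof (cases "d l = 0")
    case False
    then have pos: "d l > 0" using d l by (simp add: order_less_le)
    have "ln (1 / (n * d l)) \<le> 1 / (n * d l) - 1" using pos n by (intro ln_le_minus_one) simp
    then have "- ln (d l) \<le> ln n + (1 / (n * d l) - 1)" using pos n by (simp add: ln_div ln_mult)
    then have "d l * - ln (d l) \<le> d l * (ln n + (1 / (n * d l) - 1))" using pos by (intro mult_left_mono) auto
    moreover have "d l * (ln n + (1 / (n * d l) - 1)) = d l * ln n + (1 / n - d l)"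
      using pos n by (simp add: field_simps)
    ultimately show ?thesis by simp
  qed simp
  then have "(\<Sum>l<n. - (d l * ln (d l))) \<le> (\<Sum>l<n. d l * ln n + (1 / n - d l))"
    by (intro sum_mono) auto
  also have "\<dots> = ln n"
    using d n by (simp add: sum.distrib sum_subtractf flip: sum_distrib_right)
  finally have "- (\<Sum>l<n. d l * ln (d l)) \<le> ln n" by (simp add: sum_negf)
  then have "- (\<Sum>l<n. d l * ln (d l)) / ln b \<le> ln n / ln b"
    using b by (intro divide_right_mono) auto
  then have "- (\<Sum>l<n. d l * log b (d l)) \<le> log b n"
    by (simp add: log_def flip: sum_divide_distrib)
  then show ?thesis by (simp add: vn_entropy_spectral[OF U])
qed

subsection \<open>Kronecker products\<close>

definition kron :: "complex mat \<Rightarrow> complex mat \<Rightarrow> complex mat" where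
  "kron A B = mat (dim_row A * dim_row B) (dim_col A * dim_col B)
     (\<lambda>(r,s). A $$ (r div dim_row B, s div dim_col B) * B $$ (r mod dim_row B, s mod dim_col B))"

lemma kron_carrier [simp]:
  "A \<in> carrier_mat n n \<Longrightarrow> B \<in> carrier_mat m m \<Longrightarrow> kron A B \<in> carrier_mat (n * m) (n * m)"
  by (auto simp: kron_def)

lemma kron_index:
  assumes "A \<in> carrier_mat n n" "B \<in> carrier_mat m m" "i < n" "j < n" "p < m" "q < m"
  shows "kron A B $$ (i * m + p, j * m + q) = A $$ (i,j) * B $$ (p,q)"
  using assms block_index_less[of i n p m] block_index_less[of j n q m]
  by (auto simp: kron_def)

lemma mtrace_kron:
  assumes "A \<in> carrier_mat n n" "B \<in> carrier_mat m m"
  shows "mtrace (kron A B) = mtrace A * mtrace B"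
proof -
  have "mtrace (kron A B) = (\<Sum>i<n. \<Sum>p<m. kron A B $$ (i * m + p, i * m + p))"
    using kron_carrier[OF assms] by (simp add: mtrace_def sum_lessThan_mult)
  also have "\<dots> = mtrace A * mtrace B"
    using assms by (simp add: kron_index[OF assms] mtrace_def sum_product)
  finally show ?thesis .
qed

text \<open>Products of Gram columns are Gram columns of the product, with the pair of column
  numbers packed into one index.\<close>

lemma density_kron:
  assumes A: "density n A" and B: "density m B"
  shows "density (n * m) (kron A B)"
proof -
  note c = density_carrier[OF A] density_carrier[OF B]
  obtain F where F: "\<And>i j. i < n \<Longrightarrow> j < n \<Longrightarrow> A $$ (i,j) = (\<Sum>l<n. F i l * cnj (F j l))"
    using psd_gramE A by (metis density_def)
  obtain G where G: "\<And>i j. i < m \<Longrightarrow> j < m \<Longrightarrow> B $$ (i,j) = (\<Sum>l<m. G i l * cnj (G j l))"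
    using psd_gramE B by (metis density_def)
  have "psd (n * m) (kron A B)"
  proof (rule psd_gramI)
    fix x y assume "x < n * m" "y < n * m"
    then obtain i p j q where x: "x = i * m + p" "i < n" "p < m" and y: "y = j * m + q" "j < n" "q < m"
      by (metis block_index_cases)
    show "kron A B $$ (x, y) = (\<Sum>l<n * m. F (x div m) (l div m) * G (x mod m) (l mod m)
        * cnj (F (y div m) (l div m) * G (y mod m) (l mod m)))"
      using x y by (simp add: kron_index[OF c] F G sum_lessThan_mult sum_product complex_mult_ac)
  qed (use c in simp)
  then show ?thesis using A B by (simp add: density_def mtrace_kron[OF c])
qed

lemma spectral_decomp_kron:
  assumes A: "spectral_decomp n A U d" and B: "spectral_decomp m B V e"
  shows "spectral_decomp (n * m) (kron A B) (kron U V) (\<lambda>l. d (l div m) * e (l mod m))"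
proof -
  note a = spectral_decomp_carrier[OF A] and b = spectral_decomp_carrier[OF B]
  have "unitary (n * m) (kron U V)"
    unfolding unitary_iff
  proof (intro conjI allI impI)
    fix x y assume "x < n * m" "y < n * m"
    then obtain i p j q where x: "x = i * m + p" "i < n" "p < m" and y: "y = j * m + q" "j < n" "q < m"
      by (metis block_index_cases)
    have "(\<Sum>l<n * m. kron U V $$ (x,l) * cnj (kron U V $$ (y,l))) =
      (\<Sum>l<n. U $$ (i,l) * cnj (U $$ (j,l))) * (\<Sum>l<m. V $$ (p,l) * cnj (V $$ (q,l)))"
      using x y by (simp add: kron_index[OF a(2) b(2)] sum_lessThan_mult sum_product complex_mult_ac)
    also have "\<dots> = (if i = j \<and> p = q then 1 else 0)"
      using a(3) b(3) x y by (simp add: unitary_iff)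
    also have "i = j \<and> p = q \<longleftrightarrow> x = y"
      using x y by (metis div_mult_self3 mod_mult_self3 div_less mod_less add.right_neutral less_nat_zero_code)
    finally show "(\<Sum>l<n * m. kron U V $$ (x,l) * cnj (kron U V $$ (y,l))) = (if x = y then 1 else 0)" .
  qed (use a b in simp)
  moreover have "kron A B $$ (x,y) = (\<Sum>l<n * m. kron U V $$ (x,l) *
      of_real (d (l div m) * e (l mod m)) * cnj (kron U V $$ (y,l)))" if "x < n * m" "y < n * m" for x y
  proof -
    from that obtain i p j q where x: "x = i * m + p" "i < n" "p < m" and y: "y = j * m + q" "j < n" "q < m"
      by (metis block_index_cases)
    have "kron A B $$ (x,y) = (\<Sum>l<n. U $$ (i,l) * of_real (d l) * cnj (U $$ (j,l))) *
       (\<Sum>l<m. V $$ (p,l) * of_real (e l) * cnj (V $$ (q,l)))"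
      using A B x y by (simp add: kron_index[OF a(1) b(1)] spectral_decomp_iff)
    then show ?thesis
      using x y by (simp add: kron_index[OF a(2) b(2)] sum_lessThan_mult sum_product complex_mult_ac)
  qed
  ultimately show ?thesis
    using a b by (simp add: spectral_decomp_iff)
qed

lemma vn_entropy_kron:
  assumes b: "b > 1" and A: "density n A" and B: "density m B"
  shows "vn_entropy b (kron A B) = vn_entropy b A + vn_entropy b B"
proof -
  obtain U d where U: "spectral_decomp n A U d" and d: "\<And>l. l < n \<Longrightarrow> d l \<ge> 0" "(\<Sum>l<n. d l) = 1"
    using density_spectralE[OF A] by metis
  obtain V e where V: "spectral_decomp m B V e" and e: "\<And>l. l < m \<Longrightarrow> e l \<ge> 0" "(\<Sum>l<m. e l) = 1"
    using density_spectralE[OF B] by metis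
  \<comment> \<open>The product rule for \<open>log\<close> needs positive arguments; if one of them
    is 0, the prefactors annihilate both sides.\<close>
  have *: "x * y * log b (x * y) = x * log b x * y + x * (y * log b y)" if "x \<ge> 0" "y \<ge> 0" for x y :: real
    using that by (cases "x = 0"; cases "y = 0") (auto simp: log_mult algebra_simps)
  have "vn_entropy b (kron A B) = - (\<Sum>i<n. \<Sum>j<m. d i * e j * log b (d i * e j))"
    by (simp add: vn_entropy_spectral[OF spectral_decomp_kron[OF U V]] sum_lessThan_mult)
  also have "(\<Sum>i<n. \<Sum>j<m. d i * e j * log b (d i * e j)) =
     (\<Sum>i<n. \<Sum>j<m. d i * log b (d i) * e j + d i * (e j * log b (e j)))"
    by (intro sum.cong refl) (simp add: * d e)
  also have "\<dots> = (\<Sum>i<n. d i * log b (d i)) + (\<Sum>j<m. e j * log b (e j))"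
    by (simp add: sum.distrib d e flip: sum_distrib_left sum_distrib_right)
  finally show ?thesis
    by (simp add: vn_entropy_spectral[OF U] vn_entropy_spectral[OF V])
qed

subsection \<open>Tensor products of channels\<close>

lemma linear_map_carrier: "linear_map_on n k \<Phi> \<Longrightarrow> X \<in> carrier_mat n n \<Longrightarrow> \<Phi> X \<in> carrier_mat k k"
  by (simp add: linear_map_on_def)

lemma munit_carrier [simp]: "munit n p q \<in> carrier_mat n n"
  by (simp add: munit_def)

text \<open>\<open>tensor_map\<close> sees its factors only through their values on matrix units.
  This expansion recovers the action on whole matrices.\<close>

lemma linear_map_expand:
  assumes lin: "linear_map_on n k \<Phi>" and X: "X \<in> carrier_mat n n" and rs: "r < k" "s < k"
  shows "\<Phi> X $$ (r,s) = (\<Sum>p<n. \<Sum>q<n. X $$ (p,q) * \<Phi> (munit n p q) $$ (r,s))"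
proof -
  \<comment> \<open>Additivity is available only for two summands, so the matrix is assembled one
    position at a time.\<close>
  define part where "part S = mat n n (\<lambda>pq. if pq \<in> S then X $$ pq else 0)" for S
  have part: "part S \<in> carrier_mat n n" for S by (simp add: part_def)
  have add: "\<Phi> (X + Y) = \<Phi> X + \<Phi> Y" if "X \<in> carrier_mat n n" "Y \<in> carrier_mat n n" for X Y
    using lin that by (simp add: linear_map_on_def)
  have smult: "\<Phi> (c \<cdot>\<^sub>m X) = c \<cdot>\<^sub>m \<Phi> X" if "X \<in> carrier_mat n n" for c X
    using lin that by (simp add: linear_map_on_def)
  have "\<Phi> (part S) $$ (r,s) = (\<Sum>(p,q)\<in>S. X $$ (p,q) * \<Phi> (munit n p q) $$ (r,s))"
    if "finite S" "S \<subseteq> {..<n} \<times> {..<n}" for S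
    using that
  proof (induction S rule: finite_induct)
    case empty
    \<comment> \<open>That the zero matrix is sent to zero follows from homogeneity with the scalar
      0.\<close>
    have "part {} = 0 \<cdot>\<^sub>m part {}" by (auto simp: part_def)
    then have "\<Phi> (part {}) = 0 \<cdot>\<^sub>m \<Phi> (part {})" using smult[OF part] by metis
    then have "\<Phi> (part {}) $$ (r,s) = (0 \<cdot>\<^sub>m \<Phi> (part {})) $$ (r,s)" by simp
    also have "\<dots> = 0" using linear_map_carrier[OF lin part, of "{}"] rs by auto
    finally show ?case by simp
  next
    case (insert pq S)
    obtain p q where pq: "pq = (p,q)" by fastforce
    have "part (insert pq S) = X $$ (p,q) \<cdot>\<^sub>m munit n p q + part S"
      using insert.hyps by (intro eq_matI) (auto simp: part_def munit_def pq)
    then have "\<Phi> (part (insert pq S)) = X $$ (p,q) \<cdot>\<^sub>m \<Phi> (munit n p q) + \<Phi> (part S)"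
      by (simp add: add smult part)
    then show ?case
      using insert rs linear_map_carrier[OF lin part, of S] linear_map_carrier[OF lin munit_carrier, of p q]
      by (auto simp: pq)
  qed
  from this[of "{..<n} \<times> {..<n}"]
  have "\<Phi> (part ({..<n} \<times> {..<n})) $$ (r,s) = (\<Sum>p<n. \<Sum>q<n. X $$ (p,q) * \<Phi> (munit n p q) $$ (r,s))"
    by (simp add: sum.cartesian_product)
  moreover have "part ({..<n} \<times> {..<n}) = X" using X by (intro eq_matI) (auto simp: part_def)
  ultimately show ?thesis by simp
qed

text \<open>The block (1 (x) <p|) X (1 (x) |q>). It is a strided submatrix because the index of the
  second factor runs fastest.\<close>

definition blk :: "nat \<Rightarrow> nat \<Rightarrow> complex mat \<Rightarrow> nat \<Rightarrow> nat \<Rightarrow> complex mat" where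
  "blk a n X p q = mat a a (\<lambda>(i,j). X $$ (i * n + p, j * n + q))"

definition ptrace :: "nat \<Rightarrow> nat \<Rightarrow> complex mat \<Rightarrow> complex mat" where
  "ptrace a n X = mat a a (\<lambda>(i,j). \<Sum>p<n. X $$ (i * n + p, j * n + p))"

lemma blk_carrier [simp]: "blk a n X p q \<in> carrier_mat a a"
  by (simp add: blk_def)

lemma ptrace_carrier [simp]: "ptrace a n X \<in> carrier_mat a a"
  by (simp add: ptrace_def)

lemma tensor_map_carrier [simp]: "tensor_map \<Psi> a a' \<Phi> n k X \<in> carrier_mat (a' * k) (a' * k)"
  by (simp add: tensor_map_def)

lemma tensor_map_entry:
  assumes "r < a'" "s < a'" "u < k" "v < k"
  shows "tensor_map \<Psi> a a' \<Phi> n k X $$ (r * k + u, s * k + v) =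
    (\<Sum>i<a. \<Sum>j<a. \<Sum>p<n. \<Sum>q<n. X $$ (i * n + p, j * n + q) *
       (\<Psi> (munit a i j) $$ (r,s)) * (\<Phi> (munit n p q) $$ (u,v)))"
  using assms block_index_less[of r a' u k] block_index_less[of s a' v k]
  by (simp add: tensor_map_def)

text \<open>Only the second factor is resolved into matrix units while \<open>\<Psi>\<close> stays
  whole. This form suits inductions that peel off the last tensor factor.\<close>

lemma tensor_map_blocks:
  assumes \<Psi>: "linear_map_on a a' \<Psi>" and "r < a'" "s < a'" "u < k" "v < k"
  shows "tensor_map \<Psi> a a' \<Phi> n k X $$ (r * k + u, s * k + v) =
    (\<Sum>p<n. \<Sum>q<n. \<Psi> (blk a n X p q) $$ (r,s) * \<Phi> (munit n p q) $$ (u,v))"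
  unfolding tensor_map_entry[OF assms(2-)]
proof (subst sum_swap_pairs, intro sum.cong refl)
  fix p q
  have "\<Psi> (blk a n X p q) $$ (r,s) = (\<Sum>i<a. \<Sum>j<a. X $$ (i * n + p, j * n + q) * \<Psi> (munit a i j) $$ (r,s))"
    using assms by (subst linear_map_expand[OF \<Psi>]) (auto simp: blk_def)
  then show "(\<Sum>i<a. \<Sum>j<a. X $$ (i * n + p, j * n + q) * \<Psi> (munit a i j) $$ (r, s) *
      \<Phi> (munit n p q) $$ (u, v)) = \<Psi> (blk a n X p q) $$ (r,s) * \<Phi> (munit n p q) $$ (u,v)"
    by (simp only: sum_distrib_right)
qed

text \<open>The factorisation into \<open>\<Psi>\<close> on the first factor followed by
  \<open>\<Phi>\<close> on the second: for fixed output indices of the first factor,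
  \<open>\<Phi>\<close> acts on an ordinary n x n matrix, to which estimates for
  \<open>\<Phi>\<close> apply.\<close>

lemma tensor_map_slices:
  assumes "linear_map_on a a' \<Psi>" and \<Phi>: "linear_map_on n k \<Phi>" and "r < a'" "s < a'" "u < k" "v < k"
  shows "tensor_map \<Psi> a a' \<Phi> n k X $$ (r * k + u, s * k + v) =
    \<Phi> (mat n n (\<lambda>(p,q). \<Psi> (blk a n X p q) $$ (r,s))) $$ (u,v)"
  using assms by (subst linear_map_expand[OF \<Phi>]) (auto simp: tensor_map_blocks)

text \<open>The right-hand side is the trace of a slice as in \<open>tensor_map_slices\<close>.
  Hence trace terms in bounds for the second factor become partial traces of the input.\<close>

lemma linear_map_ptrace:
  assumes \<Psi>: "linear_map_on a a' \<Psi>" and rs: "r < a'" "s < a'"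
  shows "\<Psi> (ptrace a n X) $$ (r,s) = (\<Sum>p<n. \<Psi> (blk a n X p p) $$ (r,s))"
proof -
  have "\<Psi> (ptrace a n X) $$ (r,s) =
    (\<Sum>i<a. \<Sum>j<a. \<Sum>p<n. X $$ (i * n + p, j * n + p) * \<Psi> (munit a i j) $$ (r,s))"
    using rs by (subst linear_map_expand[OF \<Psi>]) (auto simp: ptrace_def sum_distrib_right)
  also have "\<dots> = (\<Sum>p<n. \<Sum>i<a. \<Sum>j<a. X $$ (i * n + p, j * n + p) * \<Psi> (munit a i j) $$ (r,s))"
    by (rule sum_rotate)
  also have "\<dots> = (\<Sum>p<n. \<Psi> (blk a n X p p) $$ (r,s))"
    using rs by (intro sum.cong refl, subst linear_map_expand[OF \<Psi>]) (auto simp: blk_def)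
  finally show ?thesis .
qed

lemma mtrace_ptrace:
  assumes "X \<in> carrier_mat (a * n) (a * n)"
  shows "mtrace (ptrace a n X) = mtrace X"
  using assms by (simp add: mtrace_def ptrace_def sum_lessThan_mult)

text \<open>Linear by construction, since \<open>tensor_map\<close> extends products of values on
  matrix units linearly.\<close>

lemma linear_map_tensor: "linear_map_on (a * n) (a' * k) (tensor_map \<Psi> a a' \<Phi> n k)"
  unfolding linear_map_on_def
proof (intro conjI ballI allI)
  fix X Y :: "complex mat" assume XY: "X \<in> carrier_mat (a * n) (a * n)" "Y \<in> carrier_mat (a * n) (a * n)"
  have *: "(X + Y) $$ (i * n + p, j * n + q) = X $$ (i * n + p, j * n + q) + Y $$ (i * n + p, j * n + q)"
    if "i < a" "j < a" "p < n" "q < n" for i j p q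
    using XY that by (auto simp: block_index_less)
  show "tensor_map \<Psi> a a' \<Phi> n k (X + Y) = tensor_map \<Psi> a a' \<Phi> n k X + tensor_map \<Psi> a a' \<Phi> n k Y"
    by (intro eq_matI) (auto simp: tensor_map_def * distrib_right sum.distrib)
next
  fix c and X :: "complex mat" assume X: "X \<in> carrier_mat (a * n) (a * n)"
  have *: "(c \<cdot>\<^sub>m X) $$ (i * n + p, j * n + q) = c * X $$ (i * n + p, j * n + q)"
    if "i < a" "j < a" "p < n" "q < n" for i j p q
    using X that by (auto simp: block_index_less)
  show "tensor_map \<Psi> a a' \<Phi> n k (c \<cdot>\<^sub>m X) = c \<cdot>\<^sub>m tensor_map \<Psi> a a' \<Phi> n k X"
    by (intro eq_matI) (auto simp: tensor_map_def * sum_distrib_left mult.assoc)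
qed simp

lemma linear_map_tpow:
  "linear_map_on (n ^ N) (k ^ N) (channel_tpow \<Phi> n k N)"
proof (cases N)
  case 0
  then show ?thesis by (simp add: linear_map_on_def)
next
  case (Suc M)
  then show ?thesis
    using linear_map_tensor[of "n ^ M" n "k ^ M" k "channel_tpow \<Phi> n k M" \<Phi>]
    by (simp add: mult.commute)
qed

lemma trace_preserving_tensor:
  assumes \<Psi>: "linear_map_on a a' \<Psi>" "trace_preserving a \<Psi>"
    and \<Phi>: "linear_map_on n k \<Phi>" "trace_preserving n \<Phi>"
  shows "trace_preserving (a * n) (tensor_map \<Psi> a a' \<Phi> n k)"
  unfolding trace_preserving_def
proof
  fix X :: "complex mat" assume X: "X \<in> carrier_mat (a * n) (a * n)"
  have "mtrace (tensor_map \<Psi> a a' \<Phi> n k X) =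
    (\<Sum>r<a'. \<Sum>u<k. tensor_map \<Psi> a a' \<Phi> n k X $$ (r * k + u, r * k + u))"
    by (simp only: mtrace_def carrier_matD(1)[OF tensor_map_carrier] sum_lessThan_mult)
  also have "\<dots> = (\<Sum>r<a'. mtrace (\<Phi> (mat n n (\<lambda>(p,q). \<Psi> (blk a n X p q) $$ (r,r)))))"
  proof (rule sum.cong[OF refl])
    fix r assume r: "r \<in> {..<a'}"
    let ?Z = "mat n n (\<lambda>(p,q). \<Psi> (blk a n X p q) $$ (r,r))"
    have "\<Phi> ?Z \<in> carrier_mat k k" by (rule linear_map_carrier[OF \<Phi>(1)]) simp
    then show "(\<Sum>u<k. tensor_map \<Psi> a a' \<Phi> n k X $$ (r * k + u, r * k + u)) = mtrace (\<Phi> ?Z)"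
      using r by (simp add: mtrace_def tensor_map_slices[OF \<Psi>(1) \<Phi>(1)])
  qed
  also have "\<dots> = (\<Sum>r<a'. mtrace (mat n n (\<lambda>(p,q). \<Psi> (blk a n X p q) $$ (r,r))))"
    using \<Phi>(2) by (intro sum.cong refl) (simp add: trace_preserving_def)
  also have "\<dots> = (\<Sum>r<a'. \<Psi> (ptrace a n X) $$ (r,r))"
    by (intro sum.cong refl) (simp add: mtrace_def linear_map_ptrace[OF \<Psi>(1)])
  also have "\<dots> = mtrace (\<Psi> (ptrace a n X))"
    using linear_map_carrier[OF \<Psi>(1) ptrace_carrier, of n X] by (simp add: mtrace_def)
  also have "\<dots> = mtrace X"
    using \<Psi>(2) by (simp add: trace_preserving_def mtrace_ptrace[OF X])
  finally show "mtrace (tensor_map \<Psi> a a' \<Phi> n k X) = mtrace X" .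
qed

section \<open>Kraus representations and their tensor products\<close>

definition kraus_form :: "nat \<Rightarrow> nat \<Rightarrow> (complex mat \<Rightarrow> complex mat) \<Rightarrow> bool" where
  "kraus_form n k \<Phi> \<longleftrightarrow> (\<exists>L::nat. \<exists>K. \<forall>p<n. \<forall>q<n. \<forall>r<k. \<forall>s<k.
     \<Phi> (munit n p q) $$ (r,s) = (\<Sum>l<L. K l r p * cnj (K l s q)))"

text \<open>The Kraus operators are read off a Gram decomposition of the Choi matrix.\<close>

lemma completely_positive_kraus:
  assumes "completely_positive n k \<Phi>"
  shows "kraus_form n k \<Phi>"
proof -
  \<comment> \<open>The rank-one projection, up to normalisation, onto the maximally entangled
    vector, the sum of all e_p (x) e_p. Its image is the Choi matrix.\<close>
  define X :: "complex mat" where "X = mat (n * n) (n * n)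
    (\<lambda>(x,y). if x div n = x mod n \<and> y div n = y mod n then 1 else 0)"
  have "psd (n * n) X"
    by (rule psd_gramI[where L = "Suc 0" and B = "\<lambda>x _. if x div n = x mod n then 1 else 0"])
      (auto simp: X_def)
  then have C: "psd (n * k) (tensor_map (\<lambda>Y. Y) n n \<Phi> n k X)"
    using assms by (simp add: completely_positive_def)
  obtain B where B: "\<And>i j. i < n * k \<Longrightarrow> j < n * k \<Longrightarrow>
      tensor_map (\<lambda>Y. Y) n n \<Phi> n k X $$ (i,j) = (\<Sum>l<n * k. B i l * cnj (B j l))"
    using psd_gramE[OF C] by blast
  have "\<Phi> (munit n p q) $$ (r,s) = (\<Sum>l<n * k. B (p * k + r) l * cnj (B (q * k + s) l))"
    if pq: "p < n" "q < n" and rs: "r < k" "s < k" for p q r s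
  proof -
    have "linear_map_on n n (\<lambda>Y. Y)" by (simp add: linear_map_on_def)
    then have "tensor_map (\<lambda>Y. Y) n n \<Phi> n k X $$ (p * k + r, q * k + s) =
      (\<Sum>p'<n. \<Sum>q'<n. blk n n X p' q' $$ (p,q) * \<Phi> (munit n p' q') $$ (r,s))"
      using pq rs by (rule tensor_map_blocks)
    also have "\<dots> = (\<Sum>p'<n. \<Sum>q'<n. if q' = q then if p' = p then \<Phi> (munit n p q) $$ (r,s) else 0 else 0)"
      using pq by (intro sum.cong refl) (auto simp: blk_def X_def block_index_less)
    also have "\<dots> = \<Phi> (munit n p q) $$ (r,s)" using pq by simp
    finally show ?thesis using B pq rs by (simp add: block_index_less)
  qed
  \<comment> \<open>Each Gram column, of length n k, is reshaped into a k x n Kraus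
    operator.\<close>
  then show ?thesis unfolding kraus_form_def
    by (intro exI[of _ "n * k"] exI[of _ "\<lambda>l r p. B (p * k + r) l"]) blast
qed

lemma munit_block:
  assumes "i < a" "j < a" "p < n" "q < n" "i' < a" "j' < a" "p' < n" "q' < n"
  shows "munit (a * n) (i * n + p) (j * n + q) $$ (i' * n + p', j' * n + q') =
    (if i' = i \<and> j' = j \<and> p' = p \<and> q' = q then 1 else 0)"
proof -
  have "i' * n + p' = i * n + p \<longleftrightarrow> i' = i \<and> p' = p" if "p' < n" "p < n" for i i' p p'
    using that by (metis div_mult_self3 mod_mult_self3 div_less mod_less add.right_neutral less_nat_zero_code)
  then show ?thesis using assms by (auto simp: munit_def block_index_less)
qed

text \<open>Kraus operators of the product are the Kronecker products of those of the factors. This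
  is the reason for leaving the definition of complete positivity, which does not mention a second
  nontrivial channel.\<close>

lemma kraus_form_tensor:
  assumes \<Psi>: "kraus_form a a' \<Psi>" and \<Phi>: "kraus_form n k \<Phi>"
  shows "kraus_form (a * n) (a' * k) (tensor_map \<Psi> a a' \<Phi> n k)"
proof -
  obtain L K where K: "\<And>p q r s. p < a \<Longrightarrow> q < a \<Longrightarrow> r < a' \<Longrightarrow> s < a' \<Longrightarrow>
     \<Psi> (munit a p q) $$ (r,s) = (\<Sum>l<L::nat. K l r p * cnj (K l s q))"
    using \<Psi> unfolding kraus_form_def by blast
  obtain M J where J: "\<And>p q r s. p < n \<Longrightarrow> q < n \<Longrightarrow> r < k \<Longrightarrow> s < k \<Longrightarrow>
     \<Phi> (munit n p q) $$ (r,s) = (\<Sum>l<M::nat. J l r p * cnj (J l s q))"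
    using \<Phi> unfolding kraus_form_def by blast
  define F where "F l r p = K (l div M) (r div k) (p div n) * J (l mod M) (r mod k) (p mod n)" for l r p
  have "tensor_map \<Psi> a a' \<Phi> n k (munit (a * n) x y) $$ (z,w) = (\<Sum>l<L * M. F l z x * cnj (F l w y))"
    if "x < a * n" "y < a * n" "z < a' * k" "w < a' * k" for x y z w
  proof -
    from that obtain i p j q r u s v where x: "x = i * n + p" "i < a" "p < n"
      and y: "y = j * n + q" "j < a" "q < n" and z: "z = r * k + u" "r < a'" "u < k"
      and w: "w = s * k + v" "s < a'" "v < k"
      by (metis block_index_cases)
    have "tensor_map \<Psi> a a' \<Phi> n k (munit (a * n) x y) $$ (z,w) =
      (\<Sum>i'<a. \<Sum>j'<a. \<Sum>p'<n. \<Sum>q'<n. if q' = q then if p' = p then if j' = j then if i' = i then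
         \<Psi> (munit a i j) $$ (r,s) * \<Phi> (munit n p q) $$ (u,v) else 0 else 0 else 0 else 0)"
      unfolding x(1) y(1) z(1) w(1) tensor_map_entry[OF z(2) w(2) z(3) w(3)]
      using x y by (intro sum.cong refl) (auto simp: munit_block)
    also have "\<dots> = \<Psi> (munit a i j) $$ (r,s) * \<Phi> (munit n p q) $$ (u,v)"
      using x y by simp
    also have "\<dots> = (\<Sum>l<L. K l r i * cnj (K l s j)) * (\<Sum>l<M. J l u p * cnj (J l v q))"
      using x y z w by (simp add: K J)
    also have "\<dots> = (\<Sum>l<L * M. F l z x * cnj (F l w y))"
      unfolding sum_lessThan_mult sum_product using x y z w
      by (intro sum.cong refl) (simp add: F_def)
    finally show ?thesis .
  qed
  then show ?thesis unfolding kraus_form_def by blast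
qed

text \<open>Applying every Kraus operator to every Gram column of \<open>X\<close> gives Gram
  columns of the image.\<close>

lemma kraus_form_psd:
  assumes lin: "linear_map_on n k \<Phi>" and kr: "kraus_form n k \<Phi>" and X: "psd n X"
  shows "psd k (\<Phi> X)"
proof -
  obtain L K where K: "\<And>p q r s. p < n \<Longrightarrow> q < n \<Longrightarrow> r < k \<Longrightarrow> s < k \<Longrightarrow>
     \<Phi> (munit n p q) $$ (r,s) = (\<Sum>l<L::nat. K l r p * cnj (K l s q))"
    using kr unfolding kraus_form_def by blast
  obtain G where G: "\<And>i j. i < n \<Longrightarrow> j < n \<Longrightarrow> X $$ (i,j) = (\<Sum>l<n. G i l * cnj (G j l))"
    using psd_gramE[OF X] by blast
  have Xc: "X \<in> carrier_mat n n" by (rule psd_carrier[OF X])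
  show ?thesis
  proof (rule psd_gramI)
    show "\<Phi> X \<in> carrier_mat k k" by (rule linear_map_carrier[OF lin Xc])
    fix r s assume rs: "r < k" "s < k"
    have "\<Phi> X $$ (r,s) = (\<Sum>p<n. \<Sum>q<n. (\<Sum>l<L. K l r p * cnj (K l s q)) * (\<Sum>m<n. G p m * cnj (G q m)))"
      unfolding linear_map_expand[OF lin Xc rs] using rs by (intro sum.cong refl) (simp add: K G)
    also have "\<dots> = (\<Sum>p<n. \<Sum>q<n. \<Sum>l<L. \<Sum>m<n. (K l r p * G p m) * (cnj (K l s q) * cnj (G q m)))"
      unfolding sum_product by (intro sum.cong refl) (simp only: mult_ac)
    also have "\<dots> = (\<Sum>l<L. \<Sum>m<n. \<Sum>p<n. \<Sum>q<n. (K l r p * G p m) * (cnj (K l s q) * cnj (G q m)))"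
      by (rule sum_swap_pairs)
    also have "\<dots> = (\<Sum>l<L. \<Sum>m<n. (\<Sum>p<n. K l r p * G p m) * cnj (\<Sum>p<n. K l s p * G p m))"
      by (simp only: cnj_sum complex_cnj_mult sum_product)
    also have "\<dots> = (\<Sum>x<L * n. (\<Sum>p<n. K (x div n) r p * G p (x mod n)) * cnj (\<Sum>p<n. K (x div n) s p * G p (x mod n)))"
      unfolding sum_lessThan_mult by (intro sum.cong refl) simp
    finally show "\<Phi> X $$ (r,s) = \<dots>" .
  qed
qed

text \<open>Kraus form stands in for complete positivity because all three assumptions are then
  inherited by tensor powers.\<close>

locale channel =
  fixes n k :: nat and \<Phi> :: "complex mat \<Rightarrow> complex mat"
  assumes lin: "linear_map_on n k \<Phi>" and kraus: "kraus_form n k \<Phi>" and tp: "trace_preserving n \<Phi>"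
begin

abbreviation "tpow \<equiv> channel_tpow \<Phi> n k"

lemma tpow_lin: "linear_map_on (n ^ N) (k ^ N) (tpow N)"
  by (rule linear_map_tpow)

lemma tpow_kraus: "kraus_form (n ^ N) (k ^ N) (tpow N)"
proof (induction N)
  case 0
  show ?case unfolding kraus_form_def
    by (rule exI[of _ 1], rule exI[of _ "\<lambda>_ _ _. 1"]) (auto simp: munit_def)
next
  case (Suc N)
  from kraus_form_tensor[OF Suc kraus] show ?case by (simp add: mult.commute)
qed

lemma tpow_tp: "trace_preserving (n ^ N) (tpow N)"
proof (induction N)
  case 0
  show ?case by (simp add: trace_preserving_def)
next
  case (Suc N)
  from trace_preserving_tensor[OF tpow_lin Suc lin tp] show ?case by (simp add: mult.commute)
qed

lemma tpow_density:
  assumes "density (n ^ N) \<rho>"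
  shows "density (k ^ N) (tpow N \<rho>)"
proof -
  have "psd (k ^ N) (tpow N \<rho>)"
    using kraus_form_psd[OF tpow_lin tpow_kraus] assms by (simp add: density_def)
  moreover have "mtrace (tpow N \<rho>) = mtrace \<rho>"
    using tpow_tp[of N] density_carrier[OF assms] by (simp add: trace_preserving_def)
  ultimately show ?thesis using assms by (simp add: density_def)
qed

text \<open>Tensor powers grow by one factor on the right, so splitting N + M factors into two
  groups is an associativity statement. The induction peels the last factor off
  \<open>\<sigma>\<close>.\<close>

lemma tpow_kron:
  assumes \<rho>: "\<rho> \<in> carrier_mat (n ^ N) (n ^ N)" and "\<sigma> \<in> carrier_mat (n ^ M) (n ^ M)"
  shows "tpow (N + M) (kron \<rho> \<sigma>) = kron (tpow N \<rho>) (tpow M \<sigma>)"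
  using assms(2)
proof (induction M arbitrary: \<sigma>)
  case 0
  \<comment> \<open>For exponent 0 the second input is a 1 x 1 matrix, that is, a scalar.\<close>
  let ?c = "\<sigma> $$ (0,0)"
  have c: "tpow N \<rho> \<in> carrier_mat (k ^ N) (k ^ N)" by (rule linear_map_carrier[OF tpow_lin \<rho>])
  have "kron \<rho> \<sigma> = ?c \<cdot>\<^sub>m \<rho>" using \<rho> 0 by (intro eq_matI) (auto simp: kron_def)
  moreover have "kron (tpow N \<rho>) \<sigma> = ?c \<cdot>\<^sub>m tpow N \<rho>" using c 0 by (intro eq_matI) (auto simp: kron_def)
  moreover have "tpow N (?c \<cdot>\<^sub>m \<rho>) = ?c \<cdot>\<^sub>m tpow N \<rho>"
    using tpow_lin[of N] \<rho> by (simp add: linear_map_on_def)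
  ultimately show ?case by simp
next
  case (Suc M)
  note t = linear_map_carrier[OF tpow_lin \<rho>]
  have \<sigma>: "\<sigma> \<in> carrier_mat (n ^ M * n) (n ^ M * n)" using Suc.prems by (simp add: mult.commute)
  \<comment> \<open>Fixing the indices of the last factor commutes with tensoring by
    \<open>\<rho>\<close> on the left.\<close>
  have blocks: "blk (n ^ (N + M)) n (kron \<rho> \<sigma>) p q = kron \<rho> (blk (n ^ M) n \<sigma> p q)"
    if pq: "p < n" "q < n" for p q
  proof (rule eq_matI)
    fix x y assume "x < dim_row (kron \<rho> (blk (n ^ M) n \<sigma> p q))" "y < dim_col (kron \<rho> (blk (n ^ M) n \<sigma> p q))"
    then have "x < n ^ N * n ^ M" "y < n ^ N * n ^ M"
      using kron_carrier[OF \<rho> blk_carrier, of "n ^ M" n \<sigma> p q] by auto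
    then obtain i i' j j' where x: "x = i * n ^ M + i'" "i < n ^ N" "i' < n ^ M"
      and y: "y = j * n ^ M + j'" "j < n ^ N" "j' < n ^ M" by (metis block_index_cases)
    have xx: "(i * n ^ M + i') * n + p = i * (n ^ M * n) + (i' * n + p)" for i i' p
      by (simp add: algebra_simps)
    have "blk (n ^ (N + M)) n (kron \<rho> \<sigma>) p q $$ (x,y) =
      kron \<rho> \<sigma> $$ (i * (n ^ M * n) + (i' * n + p), j * (n ^ M * n) + (j' * n + q))"
      using block_index_less[OF x(2,3)] block_index_less[OF y(2,3)]
      by (simp add: blk_def x y power_add flip: xx)
    also have "\<dots> = \<rho> $$ (i,j) * \<sigma> $$ (i' * n + p, j' * n + q)"
      using x y pq by (intro kron_index[OF \<rho> \<sigma>]) (auto simp: block_index_less)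
    also have "\<dots> = kron \<rho> (blk (n ^ M) n \<sigma> p q) $$ (x,y)"
      unfolding x(1) y(1) kron_index[OF \<rho> blk_carrier x(2) y(2) x(3) y(3)] using x y by (simp add: blk_def)
    finally show "blk (n ^ (N + M)) n (kron \<rho> \<sigma>) p q $$ (x,y) = \<dots>" .
  qed (use \<rho> in \<open>auto simp: blk_def kron_def power_add\<close>)
  have tS': "tpow (Suc M) \<sigma> \<in> carrier_mat (k ^ M * k) (k ^ M * k)" by simp
  show ?case
  proof (rule eq_matI)
    fix x y assume "x < dim_row (kron (tpow N \<rho>) (tpow (Suc M) \<sigma>))" "y < dim_col (kron (tpow N \<rho>) (tpow (Suc M) \<sigma>))"
    then have "x < (k ^ N * k ^ M) * k" "y < (k ^ N * k ^ M) * k"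
      using kron_carrier[OF t tS'] by (auto simp: mult.assoc)
    then obtain r u s v where "r < k ^ N * k ^ M" "s < k ^ N * k ^ M" and xu: "x = r * k + u" "u < k"
      and yv: "y = s * k + v" "v < k"
      by (metis block_index_cases)
    then obtain r1 r2 s1 s2 where r: "r = r1 * k ^ M + r2" "r1 < k ^ N" "r2 < k ^ M"
      and s: "s = s1 * k ^ M + s2" "s1 < k ^ N" "s2 < k ^ M" by (metis block_index_cases)
    have rs: "r < k ^ (N + M)" "s < k ^ (N + M)"
      using block_index_less[OF r(2,3)] block_index_less[OF s(2,3)] by (simp_all add: r s power_add)
    have "tpow (N + Suc M) (kron \<rho> \<sigma>) $$ (x,y) =
      (\<Sum>p<n. \<Sum>q<n. tpow (N + M) (blk (n ^ (N + M)) n (kron \<rho> \<sigma>) p q) $$ (r,s) * \<Phi> (munit n p q) $$ (u,v))"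
      unfolding xu(1) yv(1) add_Suc_right channel_tpow.simps by (rule tensor_map_blocks[OF tpow_lin rs xu(2) yv(2)])
    also have "\<dots> = (\<Sum>p<n. \<Sum>q<n. kron (tpow N \<rho>) (tpow M (blk (n ^ M) n \<sigma> p q)) $$ (r,s) * \<Phi> (munit n p q) $$ (u,v))"
      by (intro sum.cong refl) (simp add: blocks Suc.IH)
    also have "\<dots> = (\<Sum>p<n. \<Sum>q<n. tpow N \<rho> $$ (r1,s1) *
        (tpow M (blk (n ^ M) n \<sigma> p q) $$ (r2,s2) * \<Phi> (munit n p q) $$ (u,v)))"
      unfolding r(1) s(1)
      by (intro sum.cong refl, subst kron_index[OF t linear_map_carrier[OF tpow_lin blk_carrier]])
        (use r s in \<open>auto simp: mult.assoc\<close>)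
    also have "\<dots> = tpow N \<rho> $$ (r1,s1) * tpow (Suc M) \<sigma> $$ (r2 * k + u, s2 * k + v)"
      unfolding channel_tpow.simps tensor_map_blocks[OF tpow_lin r(3) s(3) xu(2) yv(2)]
      by (simp only: sum_distrib_left)
    also have "\<dots> = kron (tpow N \<rho>) (tpow (Suc M) \<sigma>) $$ (r1 * (k ^ M * k) + (r2 * k + u), s1 * (k ^ M * k) + (s2 * k + v))"
      using r s xu yv by (intro kron_index[OF t tS', symmetric]) (auto simp: block_index_less)
    also have "r1 * (k ^ M * k) + (r2 * k + u) = x" by (simp add: xu r algebra_simps)
    also have "s1 * (k ^ M * k) + (s2 * k + v) = y" by (simp add: yv s algebra_simps)
    finally show "tpow (N + Suc M) (kron \<rho> \<sigma>) $$ (x,y) = kron (tpow N \<rho>) (tpow (Suc M) \<sigma>) $$ (x,y)" .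
  qed (use t in \<open>auto simp: kron_def tensor_map_def power_add mult_ac\<close>)
qed

end

subsection \<open>Purity of tensor power outputs\<close>

lemma hs_eq: "A \<in> carrier_mat n n \<Longrightarrow> hs A = (\<Sum>i<n. \<Sum>j<n. (cmod (A $$ (i,j)))\<^sup>2)"
  by (simp add: hs_def)

text \<open>The bound is applied to each slice \<open>Z r s\<close>. Summed over all slices, the
  norms regroup into the images of the blocks of \<open>X\<close> under \<open>\<Psi>\<close>, and
  the traces into the image of the partial trace.\<close>

lemma hs_tensor_map_le:
  assumes \<Psi>: "linear_map_on a a' \<Psi>" and \<Phi>: "linear_map_on n k \<Phi>"
    and bound: "\<And>Y. Y \<in> carrier_mat n n \<Longrightarrow> hs (\<Phi> Y) \<le> \<alpha> * hs Y + \<beta> * (cmod (mtrace Y))\<^sup>2"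
  shows "hs (tensor_map \<Psi> a a' \<Phi> n k X) \<le>
    \<alpha> * (\<Sum>p<n. \<Sum>q<n. hs (\<Psi> (blk a n X p q))) + \<beta> * hs (\<Psi> (ptrace a n X))"
proof -
  define Z where "Z r s = mat n n (\<lambda>(p,q). \<Psi> (blk a n X p q) $$ (r,s))" for r s
  have Z: "Z r s \<in> carrier_mat n n" for r s by (simp add: Z_def)
  have "hs (tensor_map \<Psi> a a' \<Phi> n k X) =
    (\<Sum>r<a'. \<Sum>u<k. \<Sum>s<a'. \<Sum>v<k. (cmod (tensor_map \<Psi> a a' \<Phi> n k X $$ (r * k + u, s * k + v)))\<^sup>2)"
    by (simp only: hs_eq[OF tensor_map_carrier] sum_lessThan_mult)
  also have "\<dots> = (\<Sum>r<a'. \<Sum>s<a'. \<Sum>u<k. \<Sum>v<k. (cmod (\<Phi> (Z r s) $$ (u,v)))\<^sup>2)"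
    by (rule sum.cong[OF refl], subst sum.swap, intro sum.cong refl)
      (simp add: tensor_map_slices[OF \<Psi> \<Phi>] Z_def)
  also have "\<dots> = (\<Sum>r<a'. \<Sum>s<a'. hs (\<Phi> (Z r s)))"
    by (intro sum.cong refl) (simp add: hs_eq[OF linear_map_carrier[OF \<Phi> Z]])
  also have "\<dots> \<le> (\<Sum>r<a'. \<Sum>s<a'. \<alpha> * hs (Z r s) + \<beta> * (cmod (mtrace (Z r s)))\<^sup>2)"
    by (intro sum_mono bound Z)
  also have "\<dots> = \<alpha> * (\<Sum>r<a'. \<Sum>s<a'. hs (Z r s)) + \<beta> * (\<Sum>r<a'. \<Sum>s<a'. (cmod (mtrace (Z r s)))\<^sup>2)"
    by (simp only: sum.distrib sum_distrib_left)
  also have "(\<Sum>r<a'. \<Sum>s<a'. hs (Z r s)) =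
      (\<Sum>r<a'. \<Sum>s<a'. \<Sum>p<n. \<Sum>q<n. (cmod (\<Psi> (blk a n X p q) $$ (r,s)))\<^sup>2)"
    by (intro sum.cong refl) (simp add: hs_eq[OF Z], simp add: Z_def)
  also have "\<dots> = (\<Sum>p<n. \<Sum>q<n. hs (\<Psi> (blk a n X p q)))"
    by (subst sum_swap_pairs) (simp add: hs_eq[OF linear_map_carrier[OF \<Psi> blk_carrier]])
  also have "(\<Sum>r<a'. \<Sum>s<a'. (cmod (mtrace (Z r s)))\<^sup>2) = hs (\<Psi> (ptrace a n X))"
    unfolding hs_eq[OF linear_map_carrier[OF \<Psi> ptrace_carrier]]
    by (intro sum.cong refl) (simp add: linear_map_ptrace[OF \<Psi>] mtrace_def Z_def)
  finally show ?thesis .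
qed

text \<open>Partial trace over the middle of three factors of dimensions \<open>a\<close>,
  \<open>n\<close>, \<open>d\<close>: the last channel input is followed by the idle system, which
  has to survive.\<close>

definition mid_ptrace :: "nat \<Rightarrow> nat \<Rightarrow> nat \<Rightarrow> complex mat \<Rightarrow> complex mat" where
  "mid_ptrace a n d X = mat (a * d) (a * d)
     (\<lambda>(x,y). \<Sum>p<n. X $$ ((x div d * n + p) * d + x mod d, (y div d * n + p) * d + y mod d))"

lemma density_mid_ptrace:
  assumes X: "density (a * n * d) X"
  shows "density (a * d) (mid_ptrace a n d X)"
proof -
  note c = density_carrier[OF X]
  define L where "L = a * n * d"
  obtain G where G: "\<And>i j. i < a * n * d \<Longrightarrow> j < a * n * d \<Longrightarrow> X $$ (i,j) = (\<Sum>l<L. G i l * cnj (G j l))"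
    using psd_gramE X unfolding L_def by (metis density_def)
  have lt: "(x div d * n + p) * d + x mod d < a * n * d" if x: "x < a * d" and "p < n" for x p
  proof -
    obtain i j where "x = i * d + j" "i < a" "j < d" by (rule block_index_cases[OF x])
    then show ?thesis using that by (auto intro!: block_index_less)
  qed
  have "psd (a * d) (mid_ptrace a n d X)"
  proof (rule psd_gramI)
    show "mid_ptrace a n d X \<in> carrier_mat (a * d) (a * d)" by (simp add: mid_ptrace_def)
    fix x y assume xy: "x < a * d" "y < a * d"
    \<comment> \<open>The traced index joins the Gram index: \<open>l div L\<close> is the former
      and \<open>l mod L\<close> the latter.\<close>
    show "mid_ptrace a n d X $$ (x,y) = (\<Sum>l<n * L.
      G ((x div d * n + l div L) * d + x mod d) (l mod L) *
      cnj (G ((y div d * n + l div L) * d + y mod d) (l mod L)))"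
      using xy unfolding sum_lessThan_mult
      by (simp add: mid_ptrace_def) (intro sum.cong refl, simp add: G lt)
  qed
  moreover have "mtrace (mid_ptrace a n d X) = (\<Sum>i<a. \<Sum>x<d. \<Sum>p<n. X $$ ((i * n + p) * d + x, (i * n + p) * d + x))"
    by (simp add: mtrace_def mid_ptrace_def sum_lessThan_mult block_index_less)
  then have "mtrace (mid_ptrace a n d X) = (\<Sum>i<a. \<Sum>p<n. \<Sum>x<d. X $$ ((i * n + p) * d + x, (i * n + p) * d + x))"
    by (simp only: sum.swap[of _ "{..<d}" "{..<n}"])
  then have "mtrace (mid_ptrace a n d X) = mtrace X"
    using c by (simp add: mtrace_def sum_lessThan_mult)
  ultimately show ?thesis using X by (simp add: density_def)
qed

context channel
begin

text \<open>The blocks carry an auxiliary \<open>d\<close>-dimensional system on which nothing acts: splitting off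
  the last tensor factor turns it from \<open>d\<close> into \<open>n d\<close> in the \<open>\<alpha>\<close>-term, which is what makes
  the induction close.\<close>

lemma tpow_purity_blocks:
  assumes bound: "\<And>Y. Y \<in> carrier_mat n n \<Longrightarrow> hs (\<Phi> Y) \<le> \<alpha> * hs Y + \<beta> * (cmod (mtrace Y))\<^sup>2"
    and \<alpha>: "\<alpha> \<ge> 0" and \<beta>: "\<beta> \<ge> 0"
    and "density (n ^ N * d) \<rho>"
  shows "(\<Sum>x<d. \<Sum>y<d. hs (tpow N (blk (n ^ N) d \<rho> x y))) \<le> (\<alpha> + \<beta>) ^ N"
  using assms(4)
proof (induction N arbitrary: d \<rho>)
  case 0
  then have \<rho>: "density d \<rho>" by simp
  have "(\<Sum>x<d. \<Sum>y<d. hs (tpow 0 (blk (n ^ 0) d \<rho> x y))) = hs \<rho>"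
    using density_carrier[OF \<rho>] by (simp add: hs_def blk_def)
  then show ?case using density_hs_le_1[OF \<rho>] by simp
next
  case (Suc N)
  let ?a = "n ^ N"
  have \<rho>: "density (?a * n * d) \<rho>" using Suc.prems by (simp add: mult_ac)
  have aS: "n ^ Suc N = ?a * n" by simp
  \<comment> \<open>The split-off factor and the idle system merge into one system of dimension n d,
    with the pair (p, x) as its index.\<close>
  have b1: "blk ?a n (blk (?a * n) d \<rho> x y) p q = blk ?a (n * d) \<rho> (p * d + x) (q * d + y)"
    if "p < n" "q < n" for x y p q
  proof -
    have "(i * n + p) * d + x = i * (n * d) + (p * d + x)" for i p x
      by (simp add: algebra_simps)
    then show ?thesis using that by (intro eq_matI) (auto simp: blk_def block_index_less add.assoc)
  qed
  \<comment> \<open>Tracing out the last channel input inside a block gives a block of the reduced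
    state.\<close>
  have b2: "ptrace ?a n (blk (?a * n) d \<rho> x y) = blk ?a d (mid_ptrace ?a n d \<rho>) x y"
    if "x < d" "y < d" for x y
    using that by (intro eq_matI) (auto simp: blk_def ptrace_def mid_ptrace_def block_index_less)
  have "(\<Sum>x<d. \<Sum>y<d. hs (tpow (Suc N) (blk (n ^ Suc N) d \<rho> x y))) \<le>
    (\<Sum>x<d. \<Sum>y<d. \<alpha> * (\<Sum>p<n. \<Sum>q<n. hs (tpow N (blk ?a (n * d) \<rho> (p * d + x) (q * d + y))))
      + \<beta> * hs (tpow N (blk ?a d (mid_ptrace ?a n d \<rho>) x y)))"
  proof (intro sum_mono)
    fix x y assume "x \<in> {..<d}" "y \<in> {..<d}"
    then show "hs (tpow (Suc N) (blk (n ^ Suc N) d \<rho> x y)) \<le>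
      \<alpha> * (\<Sum>p<n. \<Sum>q<n. hs (tpow N (blk ?a (n * d) \<rho> (p * d + x) (q * d + y))))
      + \<beta> * hs (tpow N (blk ?a d (mid_ptrace ?a n d \<rho>) x y))"
      using hs_tensor_map_le[OF tpow_lin[of N] lin bound, of "blk (?a * n) d \<rho> x y"]
      by (simp add: b1 b2 aS mult.commute[of n])
  qed
  also have "\<dots> = \<alpha> * (\<Sum>x<d. \<Sum>y<d. \<Sum>p<n. \<Sum>q<n. hs (tpow N (blk ?a (n * d) \<rho> (p * d + x) (q * d + y))))
      + \<beta> * (\<Sum>x<d. \<Sum>y<d. hs (tpow N (blk ?a d (mid_ptrace ?a n d \<rho>) x y)))"
    by (simp only: sum.distrib sum_distrib_left)
  also have "(\<Sum>x<d. \<Sum>y<d. \<Sum>p<n. \<Sum>q<n. hs (tpow N (blk ?a (n * d) \<rho> (p * d + x) (q * d + y)))) =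
    (\<Sum>x<n * d. \<Sum>y<n * d. hs (tpow N (blk ?a (n * d) \<rho> x y)))"
    unfolding sum_lessThan_mult
    by (subst sum_swap_pairs) (rule sum.cong[OF refl], rule sum.swap)
  \<comment> \<open>The induction hypothesis enters twice: for \<open>\<rho>\<close> with an idle
    system of dimension n d, and for its partial trace with dimension d.\<close>
  also have "\<alpha> * \<dots> + \<beta> * (\<Sum>x<d. \<Sum>y<d. hs (tpow N (blk ?a d (mid_ptrace ?a n d \<rho>) x y))) \<le>
    \<alpha> * (\<alpha> + \<beta>) ^ N + \<beta> * (\<alpha> + \<beta>) ^ N"
    using \<alpha> \<beta> \<rho> by (intro add_mono mult_left_mono Suc.IH density_mid_ptrace) (auto simp: mult_ac)
  finally show ?case by (simp add: algebra_simps)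
qed

lemma tpow_purity:
  assumes bound: "\<And>Y. Y \<in> carrier_mat n n \<Longrightarrow> hs (\<Phi> Y) \<le> \<alpha> * hs Y + \<beta> * (cmod (mtrace Y))\<^sup>2"
    and "\<alpha> \<ge> 0" "\<beta> \<ge> 0" and \<rho>: "density (n ^ N) \<rho>"
  shows "hs (tpow N \<rho>) \<le> (\<alpha> + \<beta>) ^ N"
proof -
  have "blk (n ^ N) 1 \<rho> 0 0 = \<rho>" using density_carrier[OF \<rho>] by (intro eq_matI) (auto simp: blk_def)
  then show ?thesis using tpow_purity_blocks[OF assms(1-3), where N = N and d = 1 and \<rho> = \<rho>] \<rho> by simp
qed

end

subsection \<open>Fekete's lemma\<close>

text \<open>The linear lower bound makes the infimum over positive indices, which is the limit, a
  real number. For the sequences at hand it comes from the purity estimate.\<close>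

lemma fekete:
  fixes a :: "nat \<Rightarrow> real"
  assumes sub: "\<And>m n. a (m + n) \<le> a m + a n" and low: "\<And>n. c * real n \<le> a n"
  shows "convergent (\<lambda>n. a n / real n)"
proof -
  define L where "L = (INF n\<in>{1..}. a n / real n)"
  have bdd: "bdd_below ((\<lambda>n. a n / real n) ` {1..})"
    by (rule bdd_belowI2[of _ c]) (use low in \<open>simp add: pos_le_divide_eq\<close>)
  have "(\<lambda>n. a n / real n) \<longlonglongrightarrow> L"
  proof (rule LIMSEQ_I)
    fix e :: real assume e: "e > 0"
    have "\<exists>x\<in>(\<lambda>n. a n / real n) ` {1..}. x < L + e / 2"
      unfolding L_def by (rule cInf_lessD) (use e in auto)
    then obtain m where m: "m \<ge> 1" "a m / real m < L + e / 2" by auto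
    \<comment> \<open>Absorbs the remainder \<open>a r\<close> together with the error r / m * a m
      made when q m is replaced by n; both stay bounded as n grows.\<close>
    define C where "C = Max ((\<lambda>r. \<bar>a r\<bar>) ` {..<m}) + \<bar>a m\<bar>"
    have C: "\<bar>a r\<bar> + \<bar>a m\<bar> \<le> C" if "r < m" for r
      unfolding C_def using that by (intro add_mono Max_ge) auto
    have multiple: "a (q * m + r) \<le> real q * a m + a r" for q r
    proof (induction q)
      case (Suc q)
      have "a (Suc q * m + r) \<le> a m + a (q * m + r)" using sub[of m "q * m + r"] by (simp add: add.assoc)
      then show ?case using Suc by (simp add: algebra_simps)
    qed simp
    obtain n0 :: nat where n0: "2 * C / e < real n0" using reals_Archimedean2 by blast
    show "\<exists>no. \<forall>n\<ge>no. norm (a n / real n - L) < e"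
    proof (intro exI allI impI)
      fix n assume n: "max 1 n0 \<le> n"
      then have n1: "n \<ge> 1" by simp
      have "L \<le> a n / real n" unfolding L_def using bdd n1 by (intro cINF_lower) auto
      moreover have "a n / real n < L + e"
      proof -
        define q r where "q = n div m" and "r = n mod m"
        have nq: "n = q * m + r" and r: "r < m" using m by (simp_all add: q_def r_def)
        have "a n \<le> real q * a m + a r" using multiple[of q r] nq by simp
        also have "real q * a m = (real n - real r) * (a m / real m)"
          using m by (simp add: nq)
        also have "\<dots> = real n * (a m / real m) - (real r / real m) * a m"
          by (simp add: left_diff_distrib diff_divide_distrib)
        also have "- ((real r / real m) * a m) \<le> \<bar>a m\<bar>"
        proof -
          have "\<bar>(real r / real m) * a m\<bar> \<le> 1 * \<bar>a m\<bar>"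
            unfolding abs_mult using r by (intro mult_right_mono) auto
          then show ?thesis by linarith
        qed
        then have "real n * (a m / real m) - (real r / real m) * a m + a r \<le> real n * (a m / real m) + C"
          using C[OF r] by linarith
        finally have "a n / real n \<le> a m / real m + C / real n"
          using n1 by (simp add: field_simps)
        moreover have "C / real n \<le> e / 2"
        proof -
          have "2 * C / e < real n" using n0 n by simp
          then show ?thesis using e n1 by (simp add: field_simps)
        qed
        ultimately show ?thesis using m by linarith
      qed
      ultimately show "norm (a n / real n - L) < e" by simp
    qed
  qed
  then show ?thesis by (rule convergentI)
qed

subsection \<open>The matrix of a channel on traceless matrices\<close>

lemma sum_two_entries:
  fixes f :: "nat \<Rightarrow> nat \<Rightarrow> complex"
  assumes "i < n" "j < n" "i \<noteq> j"
    and "\<And>p q. \<not> (p = i \<and> q = j) \<Longrightarrow> \<not> (p = j \<and> q = i) \<Longrightarrow> f p q = 0"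
  shows "(\<Sum>p<n. \<Sum>q<n. f p q) = f i j + f j i"
proof -
  have "(\<Sum>p<n. \<Sum>q<n. f p q) = (\<Sum>p<n. \<Sum>q<n.
    (if q = j then if p = i then f i j else 0 else 0) + (if q = i then if p = j then f j i else 0 else 0))"
    using assms(3,4) by (intro sum.cong refl) auto
  also have "\<dots> = f i j + f j i"
    using assms(1,2) by (simp add: sum.distrib)
  finally show ?thesis .
qed

text \<open>A generalised Gell-Mann basis whose diagonal part consists of the rows of a symmetric
  orthogonal matrix with constant first row; the element \<open>(0,0)\<close> is \<open>1 / sqrt n\<close>.\<close>

definition gell_mann :: "nat \<Rightarrow> nat \<Rightarrow> nat \<Rightarrow> nat \<Rightarrow> nat \<Rightarrow> complex" where
  "gell_mann n i j p q =
    (if i = j then (if p = q then reflection (\<lambda>_. of_real (1 / sqrt n)) i p else 0)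
     else if i < j then (if p = i \<and> q = j \<or> p = j \<and> q = i then of_real (1 / sqrt 2) else 0)
     else if p = i \<and> q = j then \<i> * of_real (1 / sqrt 2)
     else if p = j \<and> q = i then - \<i> * of_real (1 / sqrt 2) else 0)"

context
  fixes n :: nat and R :: "nat \<Rightarrow> nat \<Rightarrow> complex"
  assumes n: "n > 0"
  defines "R \<equiv> reflection (\<lambda>_. of_real (1 / sqrt n))"
begin

lemma R_real: "cnj (R p q) = R p q"
  by (simp add: R_def reflection_def)

lemma R_sym: "R p q = R q p"
  by (auto simp: R_def reflection_def)

lemma R_unit: "(\<Sum>p<n. complex_of_real (1 / sqrt n) * cnj (of_real (1 / sqrt n))) = 1"
  using n by (simp flip: of_real_mult)

lemma R_orth:
  assumes "p < n" "q < n"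
  shows "(\<Sum>l<n. R p l * R q l) = (if p = q then 1 else 0)"
proof -
  have "(\<Sum>l<n. R p l * cnj (R q l)) = (if p = q then 1 else 0)"
    unfolding R_def by (rule reflection_unitary[OF n _ R_unit assms]) simp
  then show ?thesis by (simp only: R_real)
qed

lemma R_first: "p < n \<Longrightarrow> R 0 p = of_real (1 / sqrt n)"
  unfolding R_sym[of 0] unfolding R_def by (rule reflection_col_0[OF n _ R_unit]) auto

text \<open>Every other row is orthogonal to row 0, which is constant. This makes the diagonal basis
  elements traceless.\<close>

lemma R_row_sum:
  assumes "p < n" "p \<noteq> 0"
  shows "(\<Sum>l<n. R p l) = 0"
proof -
  have "(\<Sum>l<n. R p l) * of_real (1 / sqrt n) = (\<Sum>l<n. R p l * R 0 l)"
    unfolding sum_distrib_right by (intro sum.cong refl) (simp add: R_first)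
  also have "\<dots> = 0" using R_orth[of p 0] assms n by simp
  finally show ?thesis using n by simp
qed

lemma inv_sqrt2: "complex_of_real (1 / sqrt 2) * of_real (1 / sqrt 2) = 1 / 2"
  by (simp flip: of_real_mult)

lemma gell_mann_herm: "cnj (gell_mann n i j q p) = gell_mann n i j p q"
  using R_real unfolding R_def by (auto simp: gell_mann_def)

lemma gell_mann_trace:
  assumes "i < n" "(i, j) \<noteq> (0, 0)"
  shows "(\<Sum>p<n. gell_mann n i j p p) = 0"
proof -
  have "(\<Sum>p<n. gell_mann n i j p p) = (if i = j then \<Sum>p<n. R i p else 0)"
    by (auto simp: gell_mann_def R_def intro!: sum.neutral)
  then show ?thesis using assms R_row_sum[of i] by auto
qed

lemma gell_mann_zero:
  assumes "\<not> (p = i \<and> q = j)" "\<not> (p = j \<and> q = i)" "i \<noteq> j \<or> p \<noteq> q"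
  shows "gell_mann n i j p q = 0"
  using assms unfolding gell_mann_def by presburger

text \<open>A diagonal element meets only the diagonal, where the orthogonality of \<open>R\<close>
  decides; an off-diagonal one meets only (i, j) and (j, i), so two terms remain.\<close>

lemma gell_mann_orth:
  assumes "i < n" "j < n" "k < n" "l < n"
  shows "(\<Sum>p<n. \<Sum>q<n. gell_mann n i j p q * gell_mann n k l q p) = (if i = k \<and> j = l then 1 else 0)"
proof (cases "i = j")
  case True
  have "(\<Sum>p<n. \<Sum>q<n. gell_mann n i j p q * gell_mann n k l q p) =
    (\<Sum>p<n. \<Sum>q<n. if q = p then R i p * gell_mann n k l p p else 0)"
    using True by (intro sum.cong refl) (auto simp: gell_mann_def R_def)
  also have "\<dots> = (\<Sum>p<n. R i p * gell_mann n k l p p)" by simp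
  also have "\<dots> = (if k = l then \<Sum>p<n. R i p * R k p else 0)"
    by (auto simp: gell_mann_def R_def intro!: sum.neutral)
  finally show ?thesis using True R_orth[of i k] assms by auto
next
  case False
  have "(\<Sum>p<n. \<Sum>q<n. gell_mann n i j p q * gell_mann n k l q p) =
    gell_mann n i j i j * gell_mann n k l j i + gell_mann n i j j i * gell_mann n k l i j"
    by (rule sum_two_entries) (use assms False in \<open>simp_all add: gell_mann_zero\<close>)
  also have "\<dots> = (if i = k \<and> j = l then 1 else 0)"
  proof -
    define h where "h = complex_of_real (1 / sqrt 2)"
    have h: "h * h = 1 / 2" unfolding h_def by (rule inv_sqrt2)
    have gm: "gell_mann n k l p q = (if k = l then 0 else if k < l then (if p = k \<and> q = l \<or> p = l \<and> q = k then h else 0)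
        else if p = k \<and> q = l then \<i> * h else if p = l \<and> q = k then - (\<i> * h) else 0)"
      if "p \<noteq> q" for k l p q
      using that by (simp add: gell_mann_def h_def)
    have "\<i> * h * (\<i> * h) = \<i> * \<i> * (h * h)" "\<i> * h * h = \<i> * (h * h)" "h * (\<i> * h) = \<i> * (h * h)"
      by (simp_all only: mult_ac)
    then have hh: "\<i> * h * (\<i> * h) = - 1 / 2" "\<i> * h * h = \<i> / 2" "h * (\<i> * h) = \<i> / 2"
      by (simp_all only: h) simp_all
    consider "i < j" "k = l" | "i < j" "k < l" | "i < j" "l < k"
      | "j < i" "k = l" | "j < i" "k < l" | "j < i" "l < k"
      using False by (metis linorder_neqE_nat)
    then show ?thesis
      by cases (use False in \<open>simp_all add: gm h hh\<close>)
  qed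
  finally show ?thesis .
qed

lemma gell_mann_span:
  fixes X :: "nat \<Rightarrow> nat \<Rightarrow> complex"
  assumes X: "\<And>p q. p < n \<Longrightarrow> q < n \<Longrightarrow> cnj (X q p) = X p q" and tr: "(\<Sum>p<n. X p p) = 0"
  obtains c :: "nat \<Rightarrow> nat \<Rightarrow> real" where "c 0 0 = 0"
    "\<And>p q. p < n \<Longrightarrow> q < n \<Longrightarrow> (\<Sum>i<n. \<Sum>j<n. of_real (c i j) * gell_mann n i j p q) = X p q"
proof -
  \<comment> \<open>The coefficients are the inner products of \<open>X\<close> with the basis
    elements: Re and Im come from adding or subtracting an entry and its conjugate, and 2 / sqrt 2 =
    sqrt 2.\<close>
  define c where "c i j = (if i = j then Re (\<Sum>p<n. R i p * X p p)
    else if i < j then sqrt 2 * Re (X i j) else sqrt 2 * Im (X i j))" for i j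
  have cd: "of_real (c i i) = (\<Sum>p<n. R i p * X p p)" for i
  proof -
    have "cnj (\<Sum>p<n. R i p * X p p) = (\<Sum>p<n. R i p * X p p)"
      unfolding cnj_sum complex_cnj_mult R_real by (intro sum.cong refl) (simp add: X)
    then have "Im (\<Sum>p<n. R i p * X p p) = 0" by (simp only: complex_eq_iff cnj.sel) linarith
    then show ?thesis unfolding c_def by (simp only: if_True refl complex_eq_iff Re_complex_of_real Im_complex_of_real)
  qed
  \<comment> \<open>The component along the normalised identity is the trace divided by sqrt n,
    hence 0.\<close>
  have "complex_of_real (c 0 0) = of_real (1 / sqrt n) * (\<Sum>p<n. X p p)"
    unfolding cd sum_distrib_left by (intro sum.cong refl) (simp add: R_first)
  then have "c 0 0 = 0" using tr by simp
  moreover have "(\<Sum>i<n. \<Sum>j<n. of_real (c i j) * gell_mann n i j p q) = X p q" if pq: "p < n" "q < n" for p q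
  proof (cases "p = q")
    case True
    have "(\<Sum>i<n. \<Sum>j<n. of_real (c i j) * gell_mann n i j p q) =
      (\<Sum>i<n. \<Sum>j<n. if j = i then of_real (c i i) * R i p else 0)"
      using True by (intro sum.cong refl) (auto simp: gell_mann_def R_def)
    also have "\<dots> = (\<Sum>i<n. of_real (c i i) * R i p)" by (intro sum.cong refl) simp
    also have "\<dots> = (\<Sum>i<n. \<Sum>r<n. X r r * (R r i * R p i))"
      unfolding cd sum_distrib_right
    proof (intro sum.cong refl)
      fix i r
      show "R i r * X r r * R i p = X r r * (R r i * R p i)"
        using R_sym[of i r] R_sym[of i p] by simp
    qed
    also have "\<dots> = (\<Sum>r<n. X r r * (\<Sum>i<n. R r i * R p i))"
      by (subst sum.swap) (simp only: sum_distrib_left)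
    also have "\<dots> = (\<Sum>r<n. if r = p then X p p else 0)"
      using pq by (intro sum.cong refl) (auto simp: R_orth)
    finally show ?thesis using True pq by simp
  next
    case False
    have "(\<Sum>i<n. \<Sum>j<n. of_real (c i j) * gell_mann n i j p q) =
      of_real (c p q) * gell_mann n p q p q + of_real (c q p) * gell_mann n q p p q"
    proof (rule sum_two_entries[OF pq False])
      fix i j assume "\<not> (i = p \<and> j = q)" "\<not> (i = q \<and> j = p)"
      then have "gell_mann n i j p q = 0" by (intro gell_mann_zero) (use False in auto)
      then show "of_real (c i j) * gell_mann n i j p q = 0" by simp
    qed
    also have "\<dots> = X p q"
      using False X[OF pq] X[OF pq(2,1)]
      by (cases "p < q") (auto simp: gell_mann_def c_def complex_eq_iff)
    finally show ?thesis .
  qed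
  ultimately show ?thesis by (rule that)
qed

end

lemma index_mtrace_mult:
  assumes "A \<in> carrier_mat n n" "B \<in> carrier_mat n n"
  shows "mtrace (A * B) = (\<Sum>p<n. \<Sum>q<n. A $$ (p,q) * B $$ (q,p))"
proof -
  have "mtrace (A * B) = (\<Sum>p<n. (A * B) $$ (p,p))" using assms by (simp add: mtrace_def)
  also have "\<dots> = (\<Sum>p<n. \<Sum>q<n. A $$ (p,q) * B $$ (q,p))"
    by (intro sum.cong refl index_mult_sum[OF assms]) auto
  finally show ?thesis .
qed

text \<open>Needed because \<open>A_mat\<close> selects its basis by \<open>SOME\<close>; only
  existence gives the selected list its properties.\<close>

lemma onb_traceless_exists:
  assumes n: "n > 0"
  shows "\<exists>Ms. onb_traceless n Ms"
proof -
  define G where "G x = mat n n (\<lambda>(p,q). gell_mann n (x div n) (x mod n) p q)" for x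
  \<comment> \<open>Index 0, the normalised identity, is skipped, so list position \<open>i\<close>
    holds the element with number \<open>Suc i\<close>.\<close>
  define Ms where "Ms = map G [1..<n * n]"
  have len: "length Ms = n * n - 1" by (simp add: Ms_def)
  have nth: "Ms ! i = G (Suc i)" if "i < n * n - 1" for i
    using that by (simp add: Ms_def)
  have lt: "x div n < n" "x mod n < n" if "x < n * n" for x
    using that n by (simp_all add: less_mult_imp_div_less)
  have G: "G x \<in> carrier_mat n n" for x by (simp add: G_def)
  have orth: "mtrace (G x * G y) = (if x = y then 1 else 0)" if "x < n * n" "y < n * n" for x y
  proof -
    have "mtrace (G x * G y) = (if x div n = y div n \<and> x mod n = y mod n then 1 else 0)"
      unfolding index_mtrace_mult[OF G G] gell_mann_orth[OF n lt[OF that(1)] lt[OF that(2)], symmetric]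
      by (intro sum.cong refl) (simp add: G_def)
    also have "x div n = y div n \<and> x mod n = y mod n \<longleftrightarrow> x = y" by (metis div_mult_mod_eq)
    finally show ?thesis .
  qed
  have herm: "hermitian n (G x) \<and> mtrace (G x) = 0" if "0 < x" "x < n * n" for x
  proof
    show "hermitian n (G x)" by (auto simp: hermitian_iff G_def gell_mann_herm[OF n])
    have "(x div n, x mod n) \<noteq> (0,0)" using that by (metis div_mult_mod_eq prod.inject mult_zero_left add_0 less_irrefl)
    then show "mtrace (G x) = 0"
      using gell_mann_trace[OF n lt(1)[OF that(2)]] by (simp add: mtrace_def G_def)
  qed
  have span: "\<exists>c :: nat \<Rightarrow> real. X = mat n n (\<lambda>ij. \<Sum>i<length Ms. complex_of_real (c i) * (Ms ! i $$ ij))"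
    if X: "hermitian n X" "mtrace X = 0" for X
  proof -
    have Xc: "X \<in> carrier_mat n n" using X by (simp add: hermitian_def)
    obtain c where c0: "c 0 0 = 0"
      and c: "\<And>p q. p < n \<Longrightarrow> q < n \<Longrightarrow> (\<Sum>i<n. \<Sum>j<n. of_real (c i j) * gell_mann n i j p q) = X $$ (p,q)"
      by (rule gell_mann_span[OF n, of "\<lambda>p q. X $$ (p,q)"]) (use X Xc in \<open>auto simp: hermitian_iff mtrace_def\<close>)
    define d where "d x = c (x div n) (x mod n)" for x
    have "X $$ (p,q) = (\<Sum>i<length Ms. complex_of_real (d (Suc i)) * (Ms ! i $$ (p,q)))" if "p < n" "q < n" for p q
    proof -
      have "X $$ (p,q) = (\<Sum>x<n * n. of_real (d x) * G x $$ (p,q))"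
        unfolding sum_lessThan_mult c[OF that, symmetric] using that n
        by (intro sum.cong refl) (simp add: d_def G_def)
      also have "n * n = Suc (n * n - 1)" using n by simp
      also have "(\<Sum>x<Suc (n * n - 1). of_real (d x) * G x $$ (p,q)) =
        (\<Sum>i<n * n - 1. of_real (d (Suc i)) * G (Suc i) $$ (p,q))"
        by (simp only: sum.lessThan_Suc_shift) (simp add: d_def c0)
      also have "\<dots> = (\<Sum>i<length Ms. of_real (d (Suc i)) * (Ms ! i $$ (p,q)))"
        by (simp add: len nth)
      finally show ?thesis .
    qed
    then have "X = mat n n (\<lambda>ij. \<Sum>i<length Ms. complex_of_real (d (Suc i)) * (Ms ! i $$ ij))"
      using Xc by (intro eq_matI) auto
    then show ?thesis by (rule exI[of _ "\<lambda>i. d (Suc i)"])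
  qed
  have "onb_traceless n Ms"
    unfolding onb_traceless_def
  proof (intro conjI)
    show "length Ms = n\<^sup>2 - 1" by (simp add: len power2_eq_square)
    show "\<forall>M\<in>set Ms. hermitian n M \<and> mtrace M = 0" using herm by (auto simp: Ms_def)
    show "\<forall>i<length Ms. \<forall>j<length Ms. mtrace (Ms ! i * Ms ! j) = (if i = j then 1 else 0)"
      unfolding len by (auto simp: nth orth)
    show "\<forall>X. hermitian n X \<and> mtrace X = 0 \<longrightarrow>
        (\<exists>c :: nat \<Rightarrow> real. X = mat n n (\<lambda>ij. \<Sum>i<length Ms. complex_of_real (c i) * (Ms ! i $$ ij)))"
      using span by blast
  qed
  then show ?thesis by blast
qed

text \<open>For a unit vector the quadratic form is at most |A v| by Cauchy-Schwarz, and the general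
  case follows by scaling. The 0 inserted in \<open>op_norm\<close> yields nonnegativity even for
  the empty matrix.\<close>

lemma op_norm_bounds:
  assumes A: "A \<in> carrier_mat m m"
  shows op_norm_nonneg: "op_norm A \<ge> 0"
    and quadratic_form_le_op_norm: "(\<Sum>i<m. \<Sum>j<m. c i * c j * A $$ (i,j)) \<le> op_norm A * (\<Sum>i<m. (c i)\<^sup>2)"
proof -
  define w where "w v i = (\<Sum>j<m. A $$ (i,j) * v j)" for v i
  define S where "S = {sqrt (\<Sum>i<m. (w v i)\<^sup>2) | v. (\<Sum>j<m. (v j)\<^sup>2) = 1}"
  have op: "op_norm A = Sup (insert 0 S)"
    using A by (simp add: op_norm_def S_def w_def)
  \<comment> \<open>The entries of a unit vector are at most 1 in modulus, so absolute row sums give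
    a crude bound, which suffices for the supremum to be an upper bound.\<close>
  have "bdd_above (insert 0 S)"
  proof (rule bdd_aboveI)
    fix x assume "x \<in> insert 0 S"
    moreover have "sqrt (\<Sum>i<m. (w v i)\<^sup>2) \<le> sqrt (\<Sum>i<m. (\<Sum>j<m. \<bar>A $$ (i,j)\<bar>)\<^sup>2)"
      if v: "(\<Sum>j<m. (v j)\<^sup>2) = 1" for v
    proof (intro real_sqrt_le_mono sum_mono)
      fix i
      have v1: "\<bar>v j\<bar> \<le> 1" if "j < m" for j
      proof -
        have "(v j)\<^sup>2 \<le> (\<Sum>j<m. (v j)\<^sup>2)" using that by (intro member_le_sum) auto
        then show ?thesis using v by (simp add: abs_square_le_1)
      qed
      have "\<bar>w v i\<bar> \<le> (\<Sum>j<m. \<bar>A $$ (i,j) * v j\<bar>)" unfolding w_def by (rule sum_abs)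
      also have "\<dots> \<le> (\<Sum>j<m. \<bar>A $$ (i,j)\<bar> * 1)"
        unfolding abs_mult by (intro sum_mono mult_left_mono) (auto simp: v1)
      finally have "\<bar>w v i\<bar>\<^sup>2 \<le> (\<Sum>j<m. \<bar>A $$ (i,j)\<bar>)\<^sup>2" by (intro power_mono) auto
      then show "(w v i)\<^sup>2 \<le> (\<Sum>j<m. \<bar>A $$ (i,j)\<bar>)\<^sup>2" by simp
    qed
    ultimately show "x \<le> sqrt (\<Sum>i<m. (\<Sum>j<m. \<bar>A $$ (i,j)\<bar>)\<^sup>2)"
      by (auto simp: S_def intro!: real_sqrt_ge_zero sum_nonneg)
  qed
  then have upper: "x \<le> op_norm A" if "x \<in> insert 0 S" for x
    unfolding op using that by (rule cSup_upper[rotated])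
  show "op_norm A \<ge> 0" by (rule upper) simp
  define s where "s = (\<Sum>i<m. (c i)\<^sup>2)"
  show "(\<Sum>i<m. \<Sum>j<m. c i * c j * A $$ (i,j)) \<le> op_norm A * (\<Sum>i<m. (c i)\<^sup>2)"
  proof (cases "s = 0")
    case True
    then have "\<forall>i<m. (c i)\<^sup>2 = 0" unfolding s_def by (subst (asm) sum_nonneg_eq_0_iff) auto
    then show ?thesis by simp
  next
    case False
    then have s: "s > 0" unfolding s_def by (simp add: order_less_le sum_nonneg)
    define v where "v i = c i / sqrt s" for i
    have vv: "(\<Sum>i<m. (v i)\<^sup>2) = 1"
      using s by (simp add: v_def power_divide s_def flip: sum_divide_distrib)
    have "(\<Sum>i<m. v i * w v i) \<le> (\<Sum>i<m. \<bar>v i\<bar> * \<bar>w v i\<bar>)"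
      by (intro sum_mono) (simp flip: abs_mult)
    also have "\<dots> \<le> L2_set v {..<m} * L2_set (w v) {..<m}" by (rule L2_set_mult_ineq)
    also have "\<dots> = sqrt (\<Sum>i<m. (w v i)\<^sup>2)" by (simp add: L2_set_def vv)
    also have "\<dots> \<le> op_norm A" using vv by (intro upper) (auto simp: S_def)
    finally have *: "(\<Sum>i<m. v i * w v i) \<le> op_norm A" .
    have "(\<Sum>i<m. \<Sum>j<m. c i * c j * A $$ (i,j)) = s * (\<Sum>i<m. v i * w v i)"
      unfolding w_def sum_distrib_left
      by (intro sum.cong refl) (use s in \<open>simp add: v_def mult_ac\<close>)
    also have "\<dots> \<le> s * op_norm A" using * s by (intro mult_left_mono) auto
    finally show ?thesis by (simp add: s_def mult.commute)
  qed
qed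

text \<open>The norm in coordinates is the quadratic form of a Gram matrix. With the basis itself
  this is the identity matrix, with its images under the channel it is \<open>A_mat\<close>.\<close>

lemma hs_combination:
  assumes Y: "hermitian k Y" and H: "\<And>i. i < m \<Longrightarrow> H i \<in> carrier_mat k k"
    and eq: "\<And>r s. r < k \<Longrightarrow> s < k \<Longrightarrow> Y $$ (r,s) = (\<Sum>i<m. of_real (c i) * H i $$ (r,s))"
  shows "hs Y = (\<Sum>i<m. \<Sum>j<m. c i * c j * Re (mtrace (H i * H j)))"
proof -
  have Yc: "Y \<in> carrier_mat k k" using Y by (simp add: hermitian_def)
  have "complex_of_real (hs Y) = (\<Sum>r<k. \<Sum>s<k. Y $$ (r,s) * cnj (Y $$ (r,s)))"
    by (simp only: hs_eq[OF Yc] of_real_sum complex_norm_square)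
  also have "\<dots> = (\<Sum>r<k. \<Sum>s<k. Y $$ (r,s) * Y $$ (s,r))"
    using Y by (intro sum.cong refl) (simp add: hermitian_iff)
  also have "\<dots> = (\<Sum>r<k. \<Sum>s<k. \<Sum>i<m. \<Sum>j<m. of_real (c i * c j) * (H i $$ (r,s) * H j $$ (s,r)))"
  proof (intro sum.cong refl)
    fix r s assume "r \<in> {..<k}" "s \<in> {..<k}"
    then have "Y $$ (r,s) * Y $$ (s,r) = (\<Sum>i<m. of_real (c i) * H i $$ (r,s)) * (\<Sum>j<m. of_real (c j) * H j $$ (s,r))"
      by (simp add: eq)
    also have "\<dots> = (\<Sum>i<m. \<Sum>j<m. of_real (c i * c j) * (H i $$ (r,s) * H j $$ (s,r)))"
      unfolding sum_product of_real_mult by (intro sum.cong refl) (simp only: mult_ac)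
    finally show "Y $$ (r,s) * Y $$ (s,r) = \<dots>" .
  qed
  also have "\<dots> = (\<Sum>i<m. \<Sum>j<m. of_real (c i * c j) * mtrace (H i * H j))"
    by (subst sum_swap_pairs, intro sum.cong refl)
      (simp add: index_mtrace_mult[OF H H] sum_distrib_left del: of_real_mult)
  finally have "Re (complex_of_real (hs Y)) = Re (\<Sum>i<m. \<Sum>j<m. of_real (c i * c j) * mtrace (H i * H j))"
    by simp
  then show ?thesis by (simp del: of_real_mult)
qed

section \<open>The Hilbert-Schmidt bound for one channel\<close>

lemma cmod_add_i_sq: "(cmod (a + \<i> * b))\<^sup>2 = (cmod a)\<^sup>2 + (cmod b)\<^sup>2 + 2 * Im (a * cnj b)"
  unfolding cmod_power2 by (simp add: power2_eq_square algebra_simps)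

text \<open>The cross term \<open>T\<close> changes sign when its two summation indices are
  exchanged, because both matrices are Hermitian; hence it vanishes.\<close>

lemma hs_cartesian:
  assumes A: "hermitian m A" and B: "hermitian m B"
  shows "hs (A + \<i> \<cdot>\<^sub>m B) = hs A + hs B"
proof -
  have c: "A \<in> carrier_mat m m" "B \<in> carrier_mat m m" "A + \<i> \<cdot>\<^sub>m B \<in> carrier_mat m m"
    using A B by (auto simp: hermitian_def)
  define T where "T = (\<Sum>i<m. \<Sum>j<m. Im (A $$ (i,j) * cnj (B $$ (i,j))))"
  have "T = (\<Sum>j<m. \<Sum>i<m. Im (A $$ (i,j) * cnj (B $$ (i,j))))"
    unfolding T_def by (rule sum.swap)
  also have "\<dots> = (\<Sum>j<m. \<Sum>i<m. - Im (A $$ (j,i) * cnj (B $$ (j,i))))"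
  proof (intro sum.cong refl)
    fix i j assume "j \<in> {..<m}" "i \<in> {..<m}"
    then have "A $$ (i,j) = cnj (A $$ (j,i))" "B $$ (i,j) = cnj (B $$ (j,i))"
      using A B by (simp_all add: hermitian_iff)
    then show "Im (A $$ (i,j) * cnj (B $$ (i,j))) = - Im (A $$ (j,i) * cnj (B $$ (j,i)))" by simp
  qed
  also have "\<dots> = - T" by (simp only: sum_negf T_def)
  finally have T: "T = 0" by simp
  have "hs (A + \<i> \<cdot>\<^sub>m B) = (\<Sum>i<m. \<Sum>j<m. (cmod (A $$ (i,j)))\<^sup>2 + (cmod (B $$ (i,j)))\<^sup>2
      + 2 * Im (A $$ (i,j) * cnj (B $$ (i,j))))"
    unfolding hs_eq[OF c(3)] cmod_add_i_sq[symmetric] using c by (intro sum.cong refl) auto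
  also have "\<dots> = hs A + hs B + 2 * T"
    by (simp only: hs_eq[OF c(1)] hs_eq[OF c(2)] T_def sum.distrib sum_distrib_left)
  finally show ?thesis by (simp add: T)
qed

text \<open>Pythagoras: traceless matrices are orthogonal to the identity, and 1/m times the
  identity has squared norm 1/m. It is used on the input and on the output side.\<close>

lemma hs_add_scalar:
  assumes Z: "Z \<in> carrier_mat m m" and tr: "mtrace Z = 0" and m: "m > 0"
  shows "hs (Z + of_real t \<cdot>\<^sub>m ((1 / of_nat m) \<cdot>\<^sub>m 1\<^sub>m m)) = hs Z + t\<^sup>2 / real m"
proof -
  let ?Y = "Z + of_real t \<cdot>\<^sub>m ((1 / of_nat m) \<cdot>\<^sub>m 1\<^sub>m m)"
  define x where "x = t / real m"
  have Y: "?Y \<in> carrier_mat m m" using Z by simp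
  have sq: "(cmod (z + of_real x))\<^sup>2 = (cmod z)\<^sup>2 + 2 * x * Re z + x\<^sup>2" for z
    unfolding cmod_power2 by (simp add: power2_eq_square algebra_simps)
  have "hs ?Y = (\<Sum>i<m. \<Sum>j<m. (cmod (Z $$ (i,j)))\<^sup>2 + (if j = i then 2 * x * Re (Z $$ (i,i)) + x\<^sup>2 else 0))"
    unfolding hs_eq[OF Y]
  proof (intro sum.cong refl)
    fix i j assume ij: "i \<in> {..<m}" "j \<in> {..<m}"
    have "?Y $$ (i,j) = Z $$ (i,j) + (if j = i then of_real x else 0)"
      using ij Z by (auto simp: x_def)
    then show "(cmod (?Y $$ (i,j)))\<^sup>2 = (cmod (Z $$ (i,j)))\<^sup>2 + (if j = i then 2 * x * Re (Z $$ (i,i)) + x\<^sup>2 else 0)"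
      by (simp add: sq)
  qed
  also have "\<dots> = hs Z + 2 * x * Re (mtrace Z) + real m * x\<^sup>2"
    using Z by (simp add: hs_eq sum.distrib mtrace_def flip: sum_distrib_left)
  finally show ?thesis using tr m by (simp add: x_def power2_eq_square)
qed

context channel
begin

lemma hermitian_image:
  assumes X: "hermitian n X"
  shows "hermitian k (\<Phi> X)"
proof -
  have Xc: "X \<in> carrier_mat n n" and Xh: "\<And>i j. i < n \<Longrightarrow> j < n \<Longrightarrow> cnj (X $$ (j,i)) = X $$ (i,j)"
    using X by (auto simp: hermitian_iff)
  obtain L K where K: "\<And>p q r s. p < n \<Longrightarrow> q < n \<Longrightarrow> r < k \<Longrightarrow> s < k \<Longrightarrow>
     \<Phi> (munit n p q) $$ (r,s) = (\<Sum>l<L::nat. K l r p * cnj (K l s q))"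
    using kraus unfolding kraus_form_def by blast
  have "cnj (\<Phi> X $$ (s,r)) = \<Phi> X $$ (r,s)" if rs: "r < k" "s < k" for r s
  proof -
    have "cnj (\<Phi> X $$ (s,r)) = (\<Sum>p<n. \<Sum>q<n. X $$ (q,p) * \<Phi> (munit n q p) $$ (r,s))"
      unfolding linear_map_expand[OF lin Xc rs(2,1)] cnj_sum using rs
      by (intro sum.cong refl) (simp add: K Xh mult.commute)
    also have "\<dots> = \<Phi> X $$ (r,s)"
      unfolding linear_map_expand[OF lin Xc rs] by (rule sum.swap)
    finally show ?thesis .
  qed
  then show ?thesis using linear_map_carrier[OF lin Xc] by (simp add: hermitian_iff)
qed

lemma A_mat_carrier: "A_mat n \<Phi> \<in> carrier_mat (length (SOME Ms. onb_traceless n Ms)) (length (SOME Ms. onb_traceless n Ms))"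
  by (simp add: A_mat_def Let_def)

text \<open>In coordinates with respect to the selected basis, the input norm is the Euclidean norm
  of \<open>c\<close> and the output norm is the quadratic form of \<open>A_mat\<close> at
  \<open>c\<close>.\<close>

lemma hs_image_traceless_le:
  assumes n: "n > 0" and X: "hermitian n X" "mtrace X = 0"
  shows "hs (\<Phi> X) \<le> op_norm (A_mat n \<Phi>) * hs X"
proof -
  define Ms where "Ms = (SOME Ms. onb_traceless n Ms)"
  define m where "m = length Ms"
  have onb: "onb_traceless n Ms" unfolding Ms_def using onb_traceless_exists[OF n] by (rule someI_ex)
  have A: "A_mat n \<Phi> = mat m m (\<lambda>(i,j). Re (mtrace (\<Phi> (Ms ! i) * \<Phi> (Ms ! j))))"
    by (simp add: A_mat_def Let_def m_def flip: Ms_def)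
  have M: "hermitian n (Ms ! i)" if "i < m" for i using onb that by (simp add: onb_traceless_def m_def)
  then have Mc: "Ms ! i \<in> carrier_mat n n" if "i < m" for i using that by (simp add: hermitian_def)
  have Xc: "X \<in> carrier_mat n n" using X by (simp add: hermitian_def)
  obtain c :: "nat \<Rightarrow> real" where "X = mat n n (\<lambda>ij. \<Sum>i<m. complex_of_real (c i) * (Ms ! i $$ ij))"
    using onb X unfolding onb_traceless_def m_def by blast
  then have c: "X $$ (p,q) = (\<Sum>i<m. of_real (c i) * Ms ! i $$ (p,q))" if "p < n" "q < n" for p q
    using that by simp
  have "hs X = (\<Sum>i<m. \<Sum>j<m. c i * c j * Re (mtrace (Ms ! i * Ms ! j)))"
    by (rule hs_combination[OF X(1) Mc c])
  also have "\<dots> = (\<Sum>i<m. \<Sum>j<m. if j = i then (c i)\<^sup>2 else 0)"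
    using onb by (intro sum.cong refl) (auto simp: onb_traceless_def m_def power2_eq_square)
  finally have hX: "hs X = (\<Sum>i<m. (c i)\<^sup>2)" by simp
  have image: "\<Phi> X $$ (r,s) = (\<Sum>i<m. of_real (c i) * \<Phi> (Ms ! i) $$ (r,s))" if rs: "r < k" "s < k" for r s
  proof -
    have "\<Phi> X $$ (r,s) = (\<Sum>p<n. \<Sum>q<n. \<Sum>i<m. of_real (c i) * (Ms ! i $$ (p,q) * \<Phi> (munit n p q) $$ (r,s)))"
      unfolding linear_map_expand[OF lin Xc rs]
      by (intro sum.cong refl) (simp add: c sum_distrib_right mult.assoc)
    also have "\<dots> = (\<Sum>i<m. \<Sum>p<n. \<Sum>q<n. of_real (c i) * (Ms ! i $$ (p,q) * \<Phi> (munit n p q) $$ (r,s)))"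
      by (rule sum_rotate)
    also have "\<dots> = (\<Sum>i<m. of_real (c i) * \<Phi> (Ms ! i) $$ (r,s))"
      by (intro sum.cong refl) (simp add: linear_map_expand[OF lin Mc rs] sum_distrib_left)
    finally show ?thesis .
  qed
  have "hs (\<Phi> X) = (\<Sum>i<m. \<Sum>j<m. c i * c j * Re (mtrace (\<Phi> (Ms ! i) * \<Phi> (Ms ! j))))"
    by (rule hs_combination[OF hermitian_image[OF X(1)] linear_map_carrier[OF lin Mc] image])
  also have "\<dots> = (\<Sum>i<m. \<Sum>j<m. c i * c j * A_mat n \<Phi> $$ (i,j))"
    by (intro sum.cong refl) (simp add: A)
  also have "\<dots> \<le> op_norm (A_mat n \<Phi>) * (\<Sum>i<m. (c i)\<^sup>2)"
    by (rule quadratic_form_le_op_norm) (simp add: A)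
  finally show ?thesis by (simp add: hX)
qed

text \<open>Removing the trace part lowers the input norm by t^2 / n. Unitality and trace
  preservation return this part as t^2 / k orthogonally to the image of \<open>Z\<close>. This is
  the origin of the coefficient 1/k - a/n.\<close>

lemma hs_image_hermitian_le:
  assumes n: "n > 0" and k: "k > 0" and un: "unital n k \<Phi>" and Y: "hermitian n Y"
  shows "hs (\<Phi> Y) \<le> op_norm (A_mat n \<Phi>) * hs Y +
    (1 / real k - op_norm (A_mat n \<Phi>) / real n) * (cmod (mtrace Y))\<^sup>2"
proof -
  let ?a = "op_norm (A_mat n \<Phi>)" and ?I = "(1 / of_nat n) \<cdot>\<^sub>m 1\<^sub>m n :: complex mat"
  have Yc: "Y \<in> carrier_mat n n" and Yh: "\<And>i j. i < n \<Longrightarrow> j < n \<Longrightarrow> cnj (Y $$ (j,i)) = Y $$ (i,j)"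
    using Y by (auto simp: hermitian_iff)
  define t where "t = Re (mtrace Y)"
  have "cnj (mtrace Y) = mtrace Y" using Yc by (simp add: mtrace_def Yh)
  then have t: "mtrace Y = of_real t" by (simp add: t_def complex_eq_iff)
  define Z where "Z = Y + of_real (- t) \<cdot>\<^sub>m ?I"
  have Zc: "Z \<in> carrier_mat n n" using Yc by (simp add: Z_def)
  have Zh: "hermitian n Z"
    using Yc by (auto simp: hermitian_iff Z_def Yh)
  have "mtrace Z = (\<Sum>i<n. Y $$ (i,i) - of_real t / of_nat n)"
    using Yc by (simp add: mtrace_def Z_def)
  also have "\<dots> = mtrace Y - of_real t" using Yc n by (simp add: sum_subtractf mtrace_def)
  finally have Ztr: "mtrace Z = 0" by (simp add: t)
  have YZ: "Y = Z + of_real t \<cdot>\<^sub>m ?I" using Yc by (intro eq_matI) (auto simp: Z_def)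
  have "\<Phi> Y = \<Phi> Z + of_real t \<cdot>\<^sub>m \<Phi> ?I"
    using lin Zc unfolding linear_map_on_def by (subst YZ) simp
  also have "\<Phi> ?I = (1 / of_nat k) \<cdot>\<^sub>m 1\<^sub>m k" using un by (simp add: unital_def)
  finally have "hs (\<Phi> Y) = hs (\<Phi> Z) + t\<^sup>2 / real k"
    using hs_add_scalar[OF linear_map_carrier[OF lin Zc] _ k, of t] tp Zc Ztr
    by (simp add: trace_preserving_def)
  also have "\<dots> \<le> ?a * hs Z + t\<^sup>2 / real k"
    using hs_image_traceless_le[OF n Zh Ztr] by simp
  also have "hs Z = hs Y - t\<^sup>2 / real n"
    using hs_add_scalar[OF Zc Ztr n, of t] YZ by simp
  finally show ?thesis by (simp add: t algebra_simps)
qed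

text \<open>The slices of a tensor product are not Hermitian. In the decomposition into
  \<open>H1\<close> and i times \<open>H2\<close>, the squared norms and the squared modulus of the
  trace are additive, so the Hermitian bound carries over.\<close>

lemma hs_image_le:
  assumes n: "n > 0" and k: "k > 0" and un: "unital n k \<Phi>" and Y: "Y \<in> carrier_mat n n"
  shows "hs (\<Phi> Y) \<le> op_norm (A_mat n \<Phi>) * hs Y +
    (1 / real k - op_norm (A_mat n \<Phi>) / real n) * (cmod (mtrace Y))\<^sup>2"
proof -
  let ?a = "op_norm (A_mat n \<Phi>)" let ?c = "1 / real k - ?a / real n"
  define H1 where "H1 = mat n n (\<lambda>(i,j). (Y $$ (i,j) + cnj (Y $$ (j,i))) / 2)"
  define H2 where "H2 = mat n n (\<lambda>(i,j). - \<i> * (Y $$ (i,j) - cnj (Y $$ (j,i))) / 2)"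
  have h: "hermitian n H1" "hermitian n H2"
    by (auto simp: hermitian_iff H1_def H2_def algebra_simps)
  have c: "H1 \<in> carrier_mat n n" "H2 \<in> carrier_mat n n" by (simp_all add: H1_def H2_def)
  have YH: "Y = H1 + \<i> \<cdot>\<^sub>m H2"
    using Y by (intro eq_matI) (auto simp: H1_def H2_def field_simps)
  have "\<Phi> Y = \<Phi> H1 + \<i> \<cdot>\<^sub>m \<Phi> H2"
    using lin c unfolding linear_map_on_def by (subst YH) simp
  then have P: "hs (\<Phi> Y) = hs (\<Phi> H1) + hs (\<Phi> H2)"
    by (simp add: hs_cartesian[OF hermitian_image[OF h(1)] hermitian_image[OF h(2)]])
  have "hs Y = hs H1 + hs H2" by (subst YH) (rule hs_cartesian[OF h])
  moreover have "(cmod (mtrace Y))\<^sup>2 = (cmod (mtrace H1))\<^sup>2 + (cmod (mtrace H2))\<^sup>2"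
  proof -
    have r: "Im (mtrace H) = 0" if "hermitian n H" for H
    proof -
      have "cnj (mtrace H) = mtrace H" using that by (auto simp: hermitian_iff mtrace_def)
      then show ?thesis by (simp add: complex_eq_iff)
    qed
    have "mtrace Y = mtrace H1 + \<i> * mtrace H2"
      using c by (subst YH) (simp add: mtrace_def sum.distrib sum_distrib_left)
    then show ?thesis using r[OF h(1)] r[OF h(2)] by (simp add: cmod_power2)
  qed
  ultimately have "?a * hs Y + ?c * (cmod (mtrace Y))\<^sup>2 =
    (?a * hs H1 + ?c * (cmod (mtrace H1))\<^sup>2) + (?a * hs H2 + ?c * (cmod (mtrace H2))\<^sup>2)"
    by (simp add: distrib_left)
  then show ?thesis
    using P hs_image_hermitian_le[OF n k un h(1)] hs_image_hermitian_le[OF n k un h(2)] by linarith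
qed

lemma gamma_pos:
  assumes n: "n > 0" and k: "k > 0"
  shows "gamma n k \<Phi> > 0"
proof -
  let ?a = "op_norm (A_mat n \<Phi>)"
  have a: "?a \<ge> 0" by (rule op_norm_nonneg[OF A_mat_carrier])
  show ?thesis
  proof (cases "real n \<ge> real k * ?a")
    case True
    have "(1 - 1 / real n) * ?a \<ge> 0" using a n by (intro mult_nonneg_nonneg) auto
    then show ?thesis using True k by (simp add: gamma_def Let_def add_pos_nonneg)
  next
    case False
    then have "?a \<noteq> 0" by auto
    then show ?thesis using False a by (simp add: gamma_def Let_def)
  qed
qed

text \<open>The threshold in \<open>gamma\<close> is the sign of 1/k - a/n. If this is nonnegative,
  the two coefficients add up to \<open>gamma\<close>; otherwise 0 takes its place and
  \<open>gamma\<close> is the first coefficient alone.\<close>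

lemma tpow_purity_gamma:
  assumes n: "n > 0" and k: "k > 0" and un: "unital n k \<Phi>" and \<rho>: "density (n ^ N) \<rho>"
  shows "hs (tpow N \<rho>) \<le> gamma n k \<Phi> ^ N"
proof -
  let ?a = "op_norm (A_mat n \<Phi>)" let ?c = "1 / real k - ?a / real n"
  have a: "?a \<ge> 0" by (rule op_norm_nonneg[OF A_mat_carrier])
  note b = hs_image_le[OF n k un]
  show ?thesis
  proof (cases "real n \<ge> real k * ?a")
    case True
    have c: "?c \<ge> 0" using True n k by (simp add: field_simps)
    have "?a + ?c = gamma n k \<Phi>" using True by (simp add: gamma_def Let_def algebra_simps)
    then show ?thesis using tpow_purity[OF b a c \<rho>] by simp
  next
    case False
    then have c: "?c \<le> 0" using n k by (simp add: field_simps)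
    have "hs (\<Phi> Y) \<le> ?a * hs Y + 0 * (cmod (mtrace Y))\<^sup>2" if "Y \<in> carrier_mat n n" for Y
      using b[OF that] mult_nonpos_nonneg[OF c, of "(cmod (mtrace Y))\<^sup>2"] by simp
    then show ?thesis using tpow_purity[OF _ a order_refl \<rho>] False by (simp add: gamma_def Let_def)
  qed
qed

end

subsection \<open>Ensembles\<close>

text \<open>A state in every positive dimension, so that the infimum over states and the supremum
  over ensembles range over nonempty sets.\<close>

lemma density_munit:
  assumes "m > 0"
  shows "density m (munit m 0 0)"
proof -
  have "psd m (munit m 0 0)"
    by (rule psd_gramI[where L = "Suc 0" and B = "\<lambda>x _. if x = 0 then 1 else 0"])
      (auto simp: munit_def)
  moreover have "mtrace (munit m 0 0) = (\<Sum>i<m. if i = 0 then 1 else 0)"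
    by (simp add: mtrace_def munit_def)
  ultimately show ?thesis using assms by (simp add: density_def)
qed

lemma psd_zero: "psd m (0\<^sub>m m m)"
  by (rule psd_gramI[where L = 0 and B = "\<lambda>_ _. 0"]) auto

lemma psd_smult_add:
  assumes A: "psd m A" and B: "psd m B" and p: "p \<ge> 0"
  shows "psd m (of_real p \<cdot>\<^sub>m A + B)"
  unfolding psd_iff_form
proof (intro conjI allI)
  note c = psd_carrier[OF A] psd_carrier[OF B]
  have h: "hermitian m A" "hermitian m B" using A B by (simp_all add: psd_def)
  then show "hermitian m (of_real p \<cdot>\<^sub>m A + B)" by (auto simp: hermitian_iff)
  fix x
  let ?q = "\<lambda>C. \<Sum>i<m. \<Sum>j<m. cnj (x i) * C $$ (i,j) * x j"
  have "?q (of_real p \<cdot>\<^sub>m A + B) = (\<Sum>i<m. \<Sum>j<m. of_real p * (cnj (x i) * A $$ (i,j) * x j) + cnj (x i) * B $$ (i,j) * x j)"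
    using c by (intro sum.cong refl) (auto simp: algebra_simps)
  also have "\<dots> = of_real p * ?q A + ?q B"
    by (simp only: sum.distrib sum_distrib_left)
  finally have *: "Re (?q (of_real p \<cdot>\<^sub>m A + B)) = p * Re (?q A) + Re (?q B)"
    by (simp only: plus_complex.sel Re_complex_of_real Im_complex_of_real times_complex.sel mult_zero_left diff_zero)
  have "Re (?q A) \<ge> 0" "Re (?q B) \<ge> 0" using A B unfolding psd_iff_form by blast+
  then show "0 \<le> Re (?q (of_real p \<cdot>\<^sub>m A + B))" unfolding * using p by (intro add_nonneg_nonneg mult_nonneg_nonneg)
qed

definition average :: "nat \<Rightarrow> (complex mat \<Rightarrow> complex mat) \<Rightarrow> (real \<times> complex mat) list \<Rightarrow> complex mat" where
  "average m \<Psi> E = foldr (\<lambda>(p,\<rho>) acc. complex_of_real p \<cdot>\<^sub>m \<Psi> \<rho> + acc) E (0\<^sub>m m m)"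

lemma average_simps [simp]:
  "average m \<Psi> [] = 0\<^sub>m m m"
  "average m \<Psi> ((p,\<rho>) # E) = complex_of_real p \<cdot>\<^sub>m \<Psi> \<rho> + average m \<Psi> E"
  by (simp_all add: average_def)

text \<open>The trace is kept as the sum of the weights because the tail of an ensemble is not
  normalised, and the induction runs over tails.\<close>

lemma average_psd:
  assumes "\<And>p \<rho>. (p,\<rho>) \<in> set E \<Longrightarrow> p \<ge> 0 \<and> density m (\<Psi> \<rho>)"
  shows "psd m (average m \<Psi> E) \<and> mtrace (average m \<Psi> E) = of_real (\<Sum>(p,\<rho>)\<leftarrow>E. p)"
  using assms
proof (induction E)
  case Nil
  then show ?case by (simp add: psd_zero mtrace_def)
next
  case (Cons z E)
  obtain p \<rho> where z: "z = (p,\<rho>)" by fastforce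
  have IH: "psd m (average m \<Psi> E)" "mtrace (average m \<Psi> E) = of_real (\<Sum>(p,\<rho>)\<leftarrow>E. p)"
    using Cons by auto
  have p: "p \<ge> 0" "psd m (\<Psi> \<rho>)" "mtrace (\<Psi> \<rho>) = 1"
    using Cons.prems[of p \<rho>] by (auto simp: z density_def)
  have "mtrace (complex_of_real p \<cdot>\<^sub>m \<Psi> \<rho> + average m \<Psi> E) = of_real p * mtrace (\<Psi> \<rho>) + mtrace (average m \<Psi> E)"
    using psd_carrier[OF p(2)] psd_carrier[OF IH(1)] by (simp add: mtrace_def sum.distrib sum_distrib_left)
  then show ?case using psd_smult_add[OF p(2) IH(1) p(1)] IH(2) p(3) by (simp add: z)
qed

lemma average_index:
  assumes "\<And>p \<rho>. (p,\<rho>) \<in> set E \<Longrightarrow> \<Psi> \<rho> \<in> carrier_mat m m" and ij: "i < m" "j < m"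
  shows "average m \<Psi> E \<in> carrier_mat m m \<and>
    average m \<Psi> E $$ (i,j) = (\<Sum>(p,\<rho>)\<leftarrow>E. of_real p * \<Psi> \<rho> $$ (i,j))"
  using assms(1)
proof (induction E)
  case (Cons z E)
  obtain p \<rho> where z: "z = (p,\<rho>)" by fastforce
  have "average m \<Psi> E \<in> carrier_mat m m \<and>
    average m \<Psi> E $$ (i,j) = (\<Sum>(p,\<rho>)\<leftarrow>E. of_real p * \<Psi> \<rho> $$ (i,j))" "\<Psi> \<rho> \<in> carrier_mat m m"
    using Cons by (auto simp: z)
  then show ?case using ij by (auto simp: z)
qed (use ij in simp)

definition product_ensemble ::
  "(real \<times> complex mat) list \<Rightarrow> (real \<times> complex mat) list \<Rightarrow> (real \<times> complex mat) list" where
  "product_ensemble E F = concat (map (\<lambda>(p,\<rho>). map (\<lambda>(q,\<sigma>). (p * q, kron \<rho> \<sigma>)) F) E)"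

lemma sum_list_product_ensemble:
  "(\<Sum>(p,\<rho>)\<leftarrow>product_ensemble E F. f p \<rho>) =
    (\<Sum>(p,\<rho>)\<leftarrow>E. \<Sum>(q,\<sigma>)\<leftarrow>F. f (p * q) (kron \<rho> \<sigma>))"
proof (induction E)
  case (Cons z E)
  obtain p \<rho> where z: "z = (p,\<rho>)" by fastforce
  have "(\<Sum>(p,\<rho>)\<leftarrow>map (\<lambda>(q,\<sigma>). (p * q, kron \<rho> \<sigma>)) F. f p \<rho>) = (\<Sum>(q,\<sigma>)\<leftarrow>F. f (p * q) (kron \<rho> \<sigma>))"
    by (induction F) auto
  then show ?case using Cons by (simp add: product_ensemble_def z)
qed (simp add: product_ensemble_def)

lemma sum_list_product:
  fixes g :: "'a \<Rightarrow> 'c :: comm_semiring_0"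
  shows "(\<Sum>x\<leftarrow>xs. \<Sum>y\<leftarrow>ys. g x * h y) = (\<Sum>x\<leftarrow>xs. g x) * (\<Sum>y\<leftarrow>ys. h y)"
  by (induction xs) (simp_all add: sum_list_const_mult distrib_right)

section \<open>Additivity properties and the two limits\<close>

context channel
begin

context
  fixes b :: real
  assumes b: "b > 1" and n: "n > 0" and k: "k > 0" and un: "unital n k \<Phi>"
begin

lemma output_entropy_ge:
  assumes \<rho>: "density (n ^ N) \<rho>"
  shows "vn_entropy b (tpow N \<rho>) \<ge> - log b (gamma n k \<Phi>) * real N"
proof -
  note d = tpow_density[OF \<rho>]
  have "log b (hs (tpow N \<rho>)) \<le> log b (gamma n k \<Phi> ^ N)"
    using b density_hs_pos[OF d] tpow_purity_gamma[OF n k un \<rho>]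
    by (subst log_le_cancel_iff) auto
  also have "\<dots> = real N * log b (gamma n k \<Phi>)"
    using gamma_pos[OF n k] by (simp add: log_nat_power)
  finally show ?thesis using entropy_ge_collision[OF b d] by (simp add: mult.commute)
qed

text \<open>A real infimum is a lower bound only if the set is bounded below; the purity estimate
  provides the bound.\<close>

lemma S_min_tpow_le:
  assumes "density (n ^ N) \<rho>"
  shows "S_min b (n ^ N) (tpow N) \<le> vn_entropy b (tpow N \<rho>)"
  unfolding S_min_def
proof (rule cInf_lower)
  show "bdd_below ((\<lambda>\<rho>. vn_entropy b (tpow N \<rho>)) ` {\<rho>. density (n ^ N) \<rho>})"
    by (rule bdd_belowI2[of _ "- log b (gamma n k \<Phi>) * real N"]) (use output_entropy_ge in simp)
qed (use assms in auto)

lemma S_min_tpow_greatest: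
  assumes "\<And>\<rho>. density (n ^ N) \<rho> \<Longrightarrow> c \<le> vn_entropy b (tpow N \<rho>)"
  shows "c \<le> S_min b (n ^ N) (tpow N)"
  unfolding S_min_def
  by (rule cInf_greatest) (use assms density_munit[of "n ^ N"] n in auto)

lemma S_min_subadditive:
  "S_min b (n ^ (N + M)) (tpow (N + M)) \<le> S_min b (n ^ N) (tpow N) + S_min b (n ^ M) (tpow M)"
proof -
  have "S_min b (n ^ (N + M)) (tpow (N + M)) \<le> vn_entropy b (tpow N \<rho>) + vn_entropy b (tpow M \<sigma>)"
    if d: "density (n ^ N) \<rho>" "density (n ^ M) \<sigma>" for \<rho> \<sigma>
  proof -
    have "density (n ^ (N + M)) (kron \<rho> \<sigma>)" using density_kron[OF d] by (simp add: power_add)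
    then have "S_min b (n ^ (N + M)) (tpow (N + M)) \<le> vn_entropy b (tpow (N + M) (kron \<rho> \<sigma>))"
      by (rule S_min_tpow_le)
    then show ?thesis
      by (simp add: tpow_kron density_carrier d vn_entropy_kron[OF b tpow_density[OF d(1)] tpow_density[OF d(2)]])
  qed
  \<comment> \<open>The two infima are taken one after the other, first over \<open>\<rho>\<close>
    with \<open>\<sigma>\<close> fixed and then over \<open>\<sigma>\<close>.\<close>
  then have "S_min b (n ^ (N + M)) (tpow (N + M)) - vn_entropy b (tpow M \<sigma>) \<le> S_min b (n ^ N) (tpow N)"
    if "density (n ^ M) \<sigma>" for \<sigma>
    using that by (intro S_min_tpow_greatest) (simp add: diff_le_eq)
  then have "S_min b (n ^ (N + M)) (tpow (N + M)) - S_min b (n ^ N) (tpow N) \<le> S_min b (n ^ M) (tpow M)"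
    by (intro S_min_tpow_greatest) (simp add: diff_le_eq add.commute)
  then show ?thesis by simp
qed

lemma lim_S_min:
  "convergent (\<lambda>N. S_min b (n ^ N) (tpow N) / real N)"
  "lim (\<lambda>N. S_min b (n ^ N) (tpow N) / real N) \<ge> - log b (gamma n k \<Phi>)"
proof -
  have low: "- log b (gamma n k \<Phi>) * real N \<le> S_min b (n ^ N) (tpow N)" for N
    by (rule S_min_tpow_greatest) (rule output_entropy_ge)
  show conv: "convergent (\<lambda>N. S_min b (n ^ N) (tpow N) / real N)"
    by (rule fekete[OF S_min_subadditive low])
  show "lim (\<lambda>N. S_min b (n ^ N) (tpow N) / real N) \<ge> - log b (gamma n k \<Phi>)"
  proof (rule LIMSEQ_le_const)
    show "(\<lambda>N. S_min b (n ^ N) (tpow N) / real N) \<longlonglongrightarrow> lim (\<lambda>N. S_min b (n ^ N) (tpow N) / real N)"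
      using conv by (simp add: convergent_LIMSEQ_iff)
    \<comment> \<open>Index 0 is left out: there the quotient is 0 by convention, while the bound
      may be positive.\<close>
    show "\<exists>N. \<forall>m\<ge>N. - log b (gamma n k \<Phi>) \<le> S_min b (n ^ m) (tpow m) / real m"
    proof (intro exI[of _ 1] allI impI)
      fix m :: nat assume "1 \<le> m"
      then show "- log b (gamma n k \<Phi>) \<le> S_min b (n ^ m) (tpow m) / real m"
        using low[of m] by (subst pos_le_divide_eq) auto
    qed
  qed
qed

lemma ensembleD:
  assumes "ensemble m E" "(p,\<rho>) \<in> set E"
  shows "p \<ge> 0" "density m \<rho>"
  using assms by (auto simp: ensemble_def)

lemma average_density:
  assumes E: "ensemble (n ^ N) E"
  shows "density (k ^ N) (average (k ^ N) (tpow N) E)"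
proof -
  have "psd (k ^ N) (average (k ^ N) (tpow N) E) \<and>
    mtrace (average (k ^ N) (tpow N) E) = of_real (\<Sum>(p,\<rho>)\<leftarrow>E. p)"
    by (rule average_psd) (use ensembleD[OF E] tpow_density in blast)
  then show ?thesis using E by (simp add: density_def ensemble_def)
qed

lemma holevo_value_eq:
  "holevo_value b m \<Psi> E = vn_entropy b (average m \<Psi> E) - (\<Sum>(p,\<rho>)\<leftarrow>E. p * vn_entropy b (\<Psi> \<rho>))"
  by (simp add: holevo_value_def average_def)

lemma holevo_value_le:
  assumes E: "ensemble (n ^ N) E"
  shows "holevo_value b (k ^ N) (tpow N) E \<le> (log b (real k) + log b (gamma n k \<Phi>)) * real N"
proof -
  let ?g = "- log b (gamma n k \<Phi>) * real N"
  have "vn_entropy b (average (k ^ N) (tpow N) E) \<le> log b (real (k ^ N))"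
    by (rule entropy_le_log_dim[OF b average_density[OF E]]) (use k in simp)
  also have "\<dots> = log b (real k) * real N" using k by (simp add: log_nat_power)
  finally have up: "vn_entropy b (average (k ^ N) (tpow N) E) \<le> log b (real k) * real N" .
  have "(\<Sum>(p,\<rho>)\<leftarrow>E. p * ?g) \<le> (\<Sum>(p,\<rho>)\<leftarrow>E. p * vn_entropy b (tpow N \<rho>))"
    by (intro sum_list_mono) (auto intro!: mult_left_mono output_entropy_ge dest: ensembleD[OF E] simp del: mult_minus_left)
  moreover have "(\<Sum>(p,\<rho>)\<leftarrow>E. p * ?g) = (\<Sum>(p,\<rho>)\<leftarrow>E. p) * ?g"
    by (simp only: case_prod_unfold sum_list_mult_const)
  then have "(\<Sum>(p,\<rho>)\<leftarrow>E. p * ?g) = ?g" using E by (simp add: ensemble_def)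
  ultimately show ?thesis using up by (simp add: holevo_value_eq algebra_simps)
qed

lemma product_ensemble:
  assumes E: "ensemble (n ^ N) E" and F: "ensemble (n ^ M) F"
  shows "ensemble (n ^ (N + M)) (product_ensemble E F)"
  unfolding ensemble_def
proof (intro conjI)
  show "\<forall>(p,\<rho>)\<in>set (product_ensemble E F). 0 \<le> p \<and> density (n ^ (N + M)) \<rho>"
    using ensembleD[OF E] ensembleD[OF F] by (auto simp: product_ensemble_def power_add intro!: density_kron)
  have "(\<Sum>(p,\<rho>)\<leftarrow>product_ensemble E F. p) = (\<Sum>x\<leftarrow>E. fst x) * (\<Sum>y\<leftarrow>F. fst y)"
    unfolding sum_list_product_ensemble by (simp only: case_prod_unfold sum_list_product)
  then show "(\<Sum>(p,\<rho>)\<leftarrow>product_ensemble E F. p) = 1"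
    using E F by (simp add: ensemble_def case_prod_unfold)
qed

text \<open>Weights and outputs both multiply, so each entry of the average is a double sum that
  factorises.\<close>

lemma average_product:
  assumes E: "ensemble (n ^ N) E" and F: "ensemble (n ^ M) F"
  shows "average (k ^ (N + M)) (tpow (N + M)) (product_ensemble E F) =
    kron (average (k ^ N) (tpow N) E) (average (k ^ M) (tpow M) F)" (is "?L = kron ?A ?B")
proof -
  note EF = product_ensemble[OF E F]
  have AB: "?A \<in> carrier_mat (k ^ N) (k ^ N)" "?B \<in> carrier_mat (k ^ M) (k ^ M)"
    using average_density[OF E] average_density[OF F] density_carrier by blast+
  have L: "?L \<in> carrier_mat (k ^ N * k ^ M) (k ^ N * k ^ M)"
    using density_carrier[OF average_density[OF EF]] by (simp add: power_add)
  have Ec: "tpow N \<rho> \<in> carrier_mat (k ^ N) (k ^ N)" if "(p,\<rho>) \<in> set E" for p \<rho>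
    using ensembleD(2)[OF E that] by (intro density_carrier tpow_density)
  have Fc: "tpow M \<rho> \<in> carrier_mat (k ^ M) (k ^ M)" if "(p,\<rho>) \<in> set F" for p \<rho>
    using ensembleD(2)[OF F that] by (intro density_carrier tpow_density)
  have EFc: "tpow (N + M) \<rho> \<in> carrier_mat (k ^ (N + M)) (k ^ (N + M))" if "(p,\<rho>) \<in> set (product_ensemble E F)" for p \<rho>
    using ensembleD(2)[OF EF that] by (intro density_carrier tpow_density)
  show ?thesis
  proof (rule eq_matI)
    fix x y assume "x < dim_row (kron ?A ?B)" "y < dim_col (kron ?A ?B)"
    then have xy: "x < k ^ N * k ^ M" "y < k ^ N * k ^ M" using kron_carrier[OF AB] by auto
    then obtain i i' j j' where x: "x = i * k ^ M + i'" "i < k ^ N" "i' < k ^ M"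
      and y: "y = j * k ^ M + j'" "j < k ^ N" "j' < k ^ M" by (metis block_index_cases)
    have "?L $$ (x,y) = (\<Sum>(p,\<rho>)\<leftarrow>product_ensemble E F. of_real p * tpow (N + M) \<rho> $$ (x,y))"
      using average_index[of "product_ensemble E F" "tpow (N + M)" "k ^ (N + M)" x y] EFc xy
      by (simp add: power_add)
    also have "\<dots> = (\<Sum>z\<leftarrow>E. \<Sum>w\<leftarrow>F. of_real (fst z * fst w) * tpow (N + M) (kron (snd z) (snd w)) $$ (x,y))"
      unfolding sum_list_product_ensemble by (simp only: case_prod_unfold)
    also have "\<dots> = (\<Sum>z\<leftarrow>E. \<Sum>w\<leftarrow>F. (of_real (fst z) * tpow N (snd z) $$ (i,j)) * (of_real (fst w) * tpow M (snd w) $$ (i',j')))"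
    proof (intro arg_cong[where f = sum_list] map_cong refl)
      fix z w assume zw: "z \<in> set E" "w \<in> set F"
      have d: "density (n ^ N) (snd z)" "density (n ^ M) (snd w)"
        using ensembleD(2)[OF E, of "fst z" "snd z"] ensembleD(2)[OF F, of "fst w" "snd w"] zw by auto
      have "tpow (N + M) (kron (snd z) (snd w)) $$ (x,y) = tpow N (snd z) $$ (i,j) * tpow M (snd w) $$ (i',j')"
        unfolding tpow_kron[OF density_carrier[OF d(1)] density_carrier[OF d(2)]] x(1) y(1)
        by (rule kron_index[OF density_carrier[OF tpow_density[OF d(1)]] density_carrier[OF tpow_density[OF d(2)]]
              x(2) y(2) x(3) y(3)])
      then show "of_real (fst z * fst w) * tpow (N + M) (kron (snd z) (snd w)) $$ (x,y) =
        (of_real (fst z) * tpow N (snd z) $$ (i,j)) * (of_real (fst w) * tpow M (snd w) $$ (i',j'))"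
        by simp
    qed
    also have "\<dots> = ?A $$ (i,j) * ?B $$ (i',j')"
      unfolding sum_list_product
      using average_index[of E "tpow N" "k ^ N" i j] Ec x y average_index[of F "tpow M" "k ^ M" i' j'] Fc
      by (simp add: case_prod_unfold)
    also have "\<dots> = kron ?A ?B $$ (x,y)"
      unfolding x(1) y(1) by (rule kron_index[OF AB x(2) y(2) x(3) y(3), symmetric])
    finally show "?L $$ (x,y) = kron ?A ?B $$ (x,y)" .
  qed (use L kron_carrier[OF AB] in auto)
qed

lemma holevo_value_product:
  assumes E: "ensemble (n ^ N) E" and F: "ensemble (n ^ M) F"
  shows "holevo_value b (k ^ (N + M)) (tpow (N + M)) (product_ensemble E F) =
    holevo_value b (k ^ N) (tpow N) E + holevo_value b (k ^ M) (tpow M) F"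
proof -
  let ?S = "\<lambda>N z. vn_entropy b (tpow N (snd z))"
  have "(\<Sum>(p,\<rho>)\<leftarrow>product_ensemble E F. p * vn_entropy b (tpow (N + M) \<rho>)) =
    (\<Sum>z\<leftarrow>E. \<Sum>w\<leftarrow>F. (fst z * fst w) * vn_entropy b (tpow (N + M) (kron (snd z) (snd w))))"
    unfolding sum_list_product_ensemble by (simp only: case_prod_unfold)
  \<comment> \<open>Each entropy term involves one ensemble only; the weights of the other then sum
    to 1.\<close>
  also have "\<dots> = (\<Sum>z\<leftarrow>E. \<Sum>w\<leftarrow>F. (fst z * ?S N z) * fst w + fst z * (fst w * ?S M w))"
  proof (intro arg_cong[where f = sum_list] map_cong refl)
    fix z w assume zw: "z \<in> set E" "w \<in> set F"
    have d: "density (n ^ N) (snd z)" "density (n ^ M) (snd w)"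
      using ensembleD(2)[OF E, of "fst z" "snd z"] ensembleD(2)[OF F, of "fst w" "snd w"] zw by auto
    show "(fst z * fst w) * vn_entropy b (tpow (N + M) (kron (snd z) (snd w))) =
      (fst z * ?S N z) * fst w + fst z * (fst w * ?S M w)"
      unfolding tpow_kron[OF density_carrier[OF d(1)] density_carrier[OF d(2)]]
        vn_entropy_kron[OF b tpow_density[OF d(1)] tpow_density[OF d(2)]]
      by (simp add: algebra_simps)
  qed
  also have "\<dots> = (\<Sum>z\<leftarrow>E. fst z * ?S N z) + (\<Sum>w\<leftarrow>F. fst w * ?S M w)"
    using E F by (simp add: sum_list_addf sum_list_product ensemble_def case_prod_unfold)
  finally show ?thesis
    by (simp add: holevo_value_eq average_product[OF E F] case_prod_unfold
        vn_entropy_kron[OF b average_density[OF E] average_density[OF F]])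
qed

lemma holevo_tpow_ge:
  assumes "ensemble (n ^ N) E"
  shows "holevo_value b (k ^ N) (tpow N) E \<le> holevo b (n ^ N) (k ^ N) (tpow N)"
  unfolding holevo_def
proof (rule cSup_upper)
  show "bdd_above (holevo_value b (k ^ N) (tpow N) ` {E. ensemble (n ^ N) E})"
    by (rule bdd_aboveI2) (use holevo_value_le in blast)
qed (use assms in auto)

lemma holevo_tpow_least:
  assumes "\<And>E. ensemble (n ^ N) E \<Longrightarrow> holevo_value b (k ^ N) (tpow N) E \<le> c"
  shows "holevo b (n ^ N) (k ^ N) (tpow N) \<le> c"
  unfolding holevo_def
proof (rule cSup_least)
  have "ensemble (n ^ N) [(1, munit (n ^ N) 0 0)]"
    using n by (simp add: ensemble_def density_munit)
  then show "holevo_value b (k ^ N) (tpow N) ` {E. ensemble (n ^ N) E} \<noteq> {}" by blast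
qed (use assms in auto)

lemma holevo_superadditive:
  "holevo b (n ^ N) (k ^ N) (tpow N) + holevo b (n ^ M) (k ^ M) (tpow M)
    \<le> holevo b (n ^ (N + M)) (k ^ (N + M)) (tpow (N + M))" (is "?h N + ?h M \<le> ?h (N + M)")
proof -
  have "holevo_value b (k ^ N) (tpow N) E + holevo_value b (k ^ M) (tpow M) F \<le> ?h (N + M)"
    if "ensemble (n ^ N) E" "ensemble (n ^ M) F" for E F
    using holevo_tpow_ge[OF product_ensemble[OF that]] by (simp add: holevo_value_product[OF that])
  then have "?h N \<le> ?h (N + M) - holevo_value b (k ^ M) (tpow M) F" if "ensemble (n ^ M) F" for F
    using that by (intro holevo_tpow_least) (simp add: le_diff_eq)
  then have "?h M \<le> ?h (N + M) - ?h N"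
    by (intro holevo_tpow_least) (simp add: le_diff_eq add.commute)
  then show ?thesis by simp
qed

lemma lim_holevo:
  "convergent (\<lambda>N. holevo b (n ^ N) (k ^ N) (tpow N) / real N)"
  "classical_capacity b n k \<Phi> \<le> log b (real k) + log b (gamma n k \<Phi>)"
proof -
  let ?h = "\<lambda>N. holevo b (n ^ N) (k ^ N) (tpow N)" let ?c = "log b (real k) + log b (gamma n k \<Phi>)"
  have up: "?h N \<le> ?c * real N" for N
    by (rule holevo_tpow_least) (rule holevo_value_le)
  \<comment> \<open>Superadditivity and the linear upper bound become the hypotheses of
    \<open>fekete\<close> after negation.\<close>
  have "convergent (\<lambda>N. - ?h N / real N)"
  proof (rule fekete)
    show "- ?h (N + M) \<le> - ?h N + - ?h M" for N M
      using holevo_superadditive[of N M] by linarith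
    show "- ?c * real N \<le> - ?h N" for N
      using up[of N] by linarith
  qed
  then show conv: "convergent (\<lambda>N. ?h N / real N)"
    using convergent_minus_iff[of "\<lambda>N. ?h N / real N"] by simp
  show "classical_capacity b n k \<Phi> \<le> ?c"
    unfolding classical_capacity_def
  proof (rule LIMSEQ_le_const2)
    show "(\<lambda>N. ?h N / real N) \<longlonglongrightarrow> lim (\<lambda>N. ?h N / real N)"
      using conv by (simp add: convergent_LIMSEQ_iff)
    show "\<exists>N. \<forall>m\<ge>N. ?h m / real m \<le> ?c"
    proof (intro exI[of _ 1] allI impI)
      fix m :: nat assume "1 \<le> m"
      then show "?h m / real m \<le> ?c"
        using up[of m] by (subst pos_divide_le_eq) auto
    qed
  qed
qed

end

end

theorem theorem1:
  fixes \<Phi> :: "complex mat \<Rightarrow> complex mat" and n k :: nat and b :: real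
  assumes "b > 1" and "n > 0" and "k > 0"
    and "quantum_channel n k \<Phi>" and "unital n k \<Phi>"
  shows "(convergent (\<lambda>N. S_min b (n ^ N) (channel_tpow \<Phi> n k N) / real N) \<and>
          lim (\<lambda>N. S_min b (n ^ N) (channel_tpow \<Phi> n k N) / real N) \<ge> - log b (gamma n k \<Phi>))
       \<and> (convergent (\<lambda>N. holevo b (n ^ N) (k ^ N) (channel_tpow \<Phi> n k N) / real N) \<and>
          classical_capacity b n k \<Phi> \<le> log b (real k) + log b (gamma n k \<Phi>))"
proof -
  interpret channel n k \<Phi>
    using assms(4) by unfold_locales (auto simp: quantum_channel_def completely_positive_kraus)
  show ?thesis
    using lim_S_min[OF assms(1-3,5)] lim_holevo[OF assms(1-3,5)] by blast
qed

end
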